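(* Let $d=1$ and assume A1 at $\theta_0\in\Theta$. Let $u_\epsilon>0$, $u_\epsilon\to0$, $\epsilon^{-1}u_\epsilon\to\infty$ as $\epsilon\to0$. Then, for any estimator $\widehat\theta_\epsilon$, $$\liminf_{\epsilon\to0}\ \sup_{\theta\in\{\theta_0,\ \theta_0+2u_\epsilon\}}\epsilon^2u_\epsilon^{-2}I^{-1}(\theta_0)\ln\mathbf P_\theta\left(|\widehat\theta_\epsilon-\theta|\ge u_\epsilon\right)\ge-\frac12 .$$
   Context: Model: for $\epsilon>0$ one observes $Y_\epsilon(t)$, $t\in(0,1)$, with $dY_\epsilon(t)=S(t,\theta)\,dt+\epsilon\,dw(t)$, where $w$ is a standard Wiener process, $S(\cdot,\theta)\in L_2(0,1)$ is a signal, and the unknown parameter $\theta$ belongs to an open set $\Theta\subset\mathbb R^d$ (here $d=1$). $\mathbf P_\theta$ denotes probability when the parameter value is $\theta$. An estimator $\widehat\theta_\epsilon$ is a measurable function of the observation $Y_\epsilon$. A1 (at $\theta_0$): there is a function $S_\theta(\cdot,\theta_0)$ in $L_2(0,1)$ with $\int_0^1\big(S(t,\theta)-S(t,\theta_0)-(\theta-\theta_0)S_\theta(t,\theta_0)\big)^2dt=o(|\theta-\theta_0|^2)$ as $\theta\to\theta_0$, and the Fisher information $I(\theta_0)=\int_0^1S_\theta(t,\theta_0)^2\,dt$ is positive. *)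

theory Defs
  imports "HOL-Probability.Probability" "HOL-Library.Landau_Symbols"
begin

definition L2_unit :: "(real \<Rightarrow> real) set" where
  "L2_unit = {f. f \<in> borel_measurable (lebesgue_on {0<..<1}) \<and>
                 integrable (lebesgue_on {0<..<1}) (\<lambda>t. (f t)\<^sup>2)}"

definition wiener_process :: "'a measure \<Rightarrow> (real \<Rightarrow> 'a \<Rightarrow> real) \<Rightarrow> bool" where
  "wiener_process M w \<longleftrightarrow>
     (\<forall>t\<in>{0..1}. w t \<in> borel_measurable M) \<and>
     (\<forall>\<omega>\<in>space M. w 0 \<omega> = 0 \<and> continuous_on {0..1} (\<lambda>t. w t \<omega>)) \<and>
     (\<forall>s t. 0 \<le> s \<longrightarrow> s < t \<longrightarrow> t \<le> 1 \<longrightarrow>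
        distributed M lborel (\<lambda>\<omega>. w t \<omega> - w s \<omega>) (normal_density 0 (sqrt (t - s)))) \<and>
     (\<forall>(n::nat) \<tau>. strict_mono_on {..n} \<tau> \<longrightarrow> \<tau> ` {..n} \<subseteq> {0..1} \<longrightarrow>
        prob_space.indep_vars M (\<lambda>_. borel)
          (\<lambda>i \<omega>. w (\<tau> (Suc i)) \<omega> - w (\<tau> i) \<omega>) {..<n})"

(* The space C[0,1] with the sigma-algebra generated by the coordinate maps, which is
   also its Borel sigma-algebra for the supremum norm. Elements of PiM are extensional
   functions, i.e. equal to undefined outside [0,1]. *)
definition path_space :: "(real \<Rightarrow> real) measure" where
  "path_space = restrict_space (PiM {0..1} (\<lambda>_. borel)) {y. continuous_on {0..1} y}"

(* dY(t) = S(t,\<theta>) dt + \<epsilon> dw(t), in integrated form with Y(0) = 0. *)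
definition observation ::
    "(real \<Rightarrow> 'a \<Rightarrow> real) \<Rightarrow> (real \<Rightarrow> real \<Rightarrow> real) \<Rightarrow> real \<Rightarrow> real \<Rightarrow> 'a \<Rightarrow> real \<Rightarrow> real" where
  "observation w S \<epsilon> \<theta> \<omega> =
     (\<lambda>t\<in>{0..1}. integral\<^sup>L (lebesgue_on {0<..<t}) (\<lambda>s. S s \<theta>) + \<epsilon> * w t \<omega>)"

definition obs_law ::
    "'a measure \<Rightarrow> (real \<Rightarrow> 'a \<Rightarrow> real) \<Rightarrow> (real \<Rightarrow> real \<Rightarrow> real) \<Rightarrow> real \<Rightarrow> real
      \<Rightarrow> (real \<Rightarrow> real) measure" where
  "obs_law M w S \<epsilon> \<theta> = distr M path_space (observation w S \<epsilon> \<theta>)"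

definition fisher_info :: "(real \<Rightarrow> real) \<Rightarrow> real" where
  "fisher_info D = integral\<^sup>L (lebesgue_on {0<..<1}) (\<lambda>t. (D t)\<^sup>2)"

(* D plays the role of the derivative S_\<theta>(.,\<theta>0) in quadratic mean. *)
definition A1_at :: "(real \<Rightarrow> real \<Rightarrow> real) \<Rightarrow> real \<Rightarrow> (real \<Rightarrow> real) \<Rightarrow> bool" where
  "A1_at S \<theta>0 D \<longleftrightarrow>
     D \<in> L2_unit \<and>
     (\<lambda>\<theta>. integral\<^sup>L (lebesgue_on {0<..<1}) (\<lambda>t. (S t \<theta> - S t \<theta>0 - (\<theta> - \<theta>0) * D t)\<^sup>2))
       \<in> o[at \<theta>0](\<lambda>\<theta>. \<bar>\<theta> - \<theta>0\<bar>\<^sup>2) \<and>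
     fisher_info D > 0"

(* The logarithm with value -\<infinity> at 0; the library's ln satisfies ln 0 = 0, which is
   the wrong convention for logarithms of probabilities. *)
definition eln :: "real \<Rightarrow> ereal" where
  "eln p = (if p \<le> 0 then -\<infinity> else ereal (ln p))"

end

theory Submission
  imports Defs
begin

text \<open>
  Since the two parameter values are \<open>2 u\<close> apart, the estimator misses at least one of them
  by \<open>u\<close>, so the two error probabilities sum to at least \<open>P\<^sub>0(E) + P\<^sub>1(E\<^sup>c)\<close>, where \<open>E\<close> is
  the error event at the first value. For cylinder events \<open>E\<close> only finitely many Gaussian
  increments matter. Relative to the measure \<open>Q\<close> halfway between \<open>P\<^sub>0\<close> and \<open>P\<^sub>1\<close> the densities are
  \<open>exp (\<plusminus>V - q)\<close> with \<open>E\<^sub>Q V\<^sup>2 = 2 q \<le> \<kappa>\<^sup>2\<close>, where \<open>\<kappa> \<ge> \<parallel>S\<^sub>1 - S\<^sub>0\<parallel> / (2 \<epsilon>)\<close>, and Jensen's inequality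
  bounds \<open>E\<^sub>Q exp (-\<bar>V\<bar> - q)\<close> below by \<open>exp (-\<kappa>\<^sup>2 / 2 - \<kappa>)\<close>. By Cauchy-Schwarz this bound does not
  depend on the partition of \<open>[0,1]\<close>, so it extends to all events by approximation, and neither
  stochastic integrals nor Girsanov's theorem are needed. Under A1, \<open>\<kappa>\<close> may be chosen as
  \<open>(1 + \<eta>) u \<surd>I / \<epsilon>\<close>, which tends to infinity; hence only the quadratic term of the exponent survives.
\<close>

section \<open>Shifted Gaussian vectors\<close>

text \<open>Both sides agree on boxes, because the product density integrates over a box coordinate
  by coordinate, and boxes determine a finite product of sigma-finite measures.\<close>

lemma PiM_density:
  fixes N :: "'i \<Rightarrow> 'b measure" and l :: "'i \<Rightarrow> 'b \<Rightarrow> ennreal"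
  assumes I: "finite I"
    and prob: "\<And>i. prob_space (N i)" "\<And>i. prob_space (density (N i) (l i))"
    and l[measurable]: "\<And>i. l i \<in> borel_measurable (N i)"
  shows "PiM I (\<lambda>i. density (N i) (l i)) = density (PiM I N) (\<lambda>x. \<Prod>i\<in>I. l i (x i))"
proof -
  interpret N: product_sigma_finite N
    by (simp add: product_sigma_finite_def prob_space_imp_sigma_finite prob)
  interpret L: product_sigma_finite "\<lambda>i. density (N i) (l i)"
    by (simp add: product_sigma_finite_def prob_space_imp_sigma_finite prob)
  have "density (PiM I N) (\<lambda>x. \<Prod>i\<in>I. l i (x i)) = PiM I (\<lambda>i. density (N i) (l i))"
  proof (rule L.PiM_eqI[OF I])
    show "sets (density (PiM I N) (\<lambda>x. \<Prod>i\<in>I. l i (x i))) = sets (Pi\<^sub>M I (\<lambda>i. density (N i) (l i)))"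
      by (simp cong: sets_PiM_cong)
    fix A assume "\<And>i. i \<in> I \<Longrightarrow> A i \<in> sets (density (N i) (l i))"
    then have A: "\<And>i. i \<in> I \<Longrightarrow> A i \<in> sets (N i)" by simp
    have "emeasure (density (PiM I N) (\<lambda>x. \<Prod>i\<in>I. l i (x i))) (Pi\<^sub>E I A)
        = (\<integral>\<^sup>+x. (\<Prod>i\<in>I. l i (x i)) * indicator (Pi\<^sub>E I A) x \<partial>PiM I N)"
      using A I by (intro emeasure_density) (auto intro!: sets_PiM_I_finite)
    also have "\<dots> = (\<integral>\<^sup>+x. (\<Prod>i\<in>I. l i (x i) * indicator (A i) (x i)) \<partial>PiM I N)"
    proof (rule nn_integral_cong)
      fix x assume "x \<in> space (PiM I N)"
      \<comment> \<open>Membership in a box splits into coordinate conditions only for extensional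
        points, so the factorisation of the indicator is restricted to the space of the
        product.\<close>
      then have "x \<in> extensional I" by (auto simp: space_PiM PiE_def)
      then have "indicator (Pi\<^sub>E I A) x = (\<Prod>i\<in>I. indicator (A i) (x i) :: ennreal)"
        using I by (auto simp: indicator_def PiE_iff prod_zero_iff intro!: prod.neutral)
      then show "(\<Prod>i\<in>I. l i (x i)) * indicator (Pi\<^sub>E I A) x
          = (\<Prod>i\<in>I. l i (x i) * indicator (A i) (x i))"
        by (simp add: prod.distrib)
    qed
    also have "\<dots> = (\<Prod>i\<in>I. \<integral>\<^sup>+y. l i y * indicator (A i) y \<partial>N i)"
      using A by (intro N.product_nn_integral_prod I) auto
    also have "\<dots> = (\<Prod>i\<in>I. emeasure (density (N i) (l i)) (A i))"
      using A by (intro prod.cong) (auto simp: emeasure_density)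
    finally show "emeasure (density (PiM I N) (\<lambda>x. \<Prod>i\<in>I. l i (x i))) (Pi\<^sub>E I A)
        = (\<Prod>i\<in>I. emeasure (density (N i) (l i)) (A i))" .
  qed
  then show ?thesis by simp
qed

text \<open>The Gaussian likelihood ratio, obtained by expanding
  \<open>(x - h)\<^sup>2\<close>.\<close>

lemma normal_density_shift:
  assumes "s > 0"
  shows "normal_density h s x = normal_density 0 s x * exp (h * x / s\<^sup>2 - h\<^sup>2 / (2 * s\<^sup>2))"
  unfolding normal_density_def using assms
  by (simp add: exp_add[symmetric] field_simps power2_eq_square)

context prob_space
begin

text \<open>Finite-dimensional Cameron-Martin formula. By independence, the joint laws of the
  original and the translated vector are both product measures; \<open>PiM_density\<close>
  multiplies the one-dimensional likelihood ratios, and the identity is then pulled back to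
  \<open>M\<close>.\<close>

lemma indep_vars_shift_normal:
  fixes X :: "'i \<Rightarrow> 'a \<Rightarrow> real" and h s :: "'i \<Rightarrow> real"
  assumes I: "finite I" "I \<noteq> {}"
    and ind: "indep_vars (\<lambda>_. borel) X I"
    and s: "\<And>i. i \<in> I \<Longrightarrow> 0 < s i"
    and X: "\<And>i. i \<in> I \<Longrightarrow> distributed M lborel (X i) (normal_density 0 (s i))"
    and B[measurable]: "B \<in> sets (PiM I (\<lambda>_. borel))"
  shows "emeasure M {\<omega> \<in> space M. (\<lambda>i\<in>I. X i \<omega> + h i) \<in> B}
    = (\<integral>\<^sup>+\<omega>. indicator B (\<lambda>i\<in>I. X i \<omega>)
          * ennreal (exp ((\<Sum>i\<in>I. h i * X i \<omega> / (s i)\<^sup>2) - (\<Sum>i\<in>I. (h i)\<^sup>2 / (2 * (s i)\<^sup>2)))) \<partial>M)"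
proof -
  \<comment> \<open>Outside \<open>I\<close> the deviation is set to 1, so that every
    \<open>N i\<close> is a probability measure, as the product construction asks of all
    indices.\<close>
  define s' where "s' i = (if i \<in> I then s i else 1)" for i
  have s': "s' i > 0" for i by (simp add: s'_def s)
  define N where "N i = density lborel (normal_density 0 (s' i))" for i
  define N' where "N' i = density lborel (normal_density (h i) (s' i))" for i
  define l where "l i x = ennreal (exp (h i * x / (s' i)\<^sup>2 - (h i)\<^sup>2 / (2 * (s' i)\<^sup>2)))" for i x
  have l[measurable]: "l i \<in> borel_measurable borel" for i
    unfolding l_def by measurable
  have N': "N' i = density (N i) (l i)" for i
    unfolding N'_def N_def l_def
    by (subst density_density_eq)
       (auto intro!: density_cong simp: ennreal_mult'[symmetric] normal_density_shift[OF s', of "h i"])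
  have setsN: "sets (N i) = sets borel" for i by (simp add: N_def)
  have probN: "prob_space (N i)" "prob_space (N' i)" for i
    using s' by (auto simp: N_def N'_def intro!: prob_space_normal_density)
  have X_m[measurable]: "i \<in> I \<Longrightarrow> X i \<in> borel_measurable M" for i
    using X[of i] by (auto simp: distributed_def)
  have dX: "distr M borel (X i) = N i" if "i \<in> I" for i
    using X[OF that] that
    by (auto simp: distributed_def N_def s'_def cong: distr_cong)
  have dX': "distr M borel (\<lambda>\<omega>. X i \<omega> + h i) = N' i" if "i \<in> I" for i
    using normal_density_affine[OF X[OF that] s[OF that], of 1 "h i"] that
    by (auto simp: distributed_def N'_def s'_def add.commute cong: distr_cong)
  have D: "distr M (PiM I (\<lambda>_. borel)) (\<lambda>\<omega>. \<lambda>i\<in>I. X i \<omega>) = PiM I N"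
    using ind I(2) by (subst (asm) indep_vars_iff_distr_eq_PiM') (auto simp: dX cong: PiM_cong)
  have ind': "indep_vars (\<lambda>_. borel) (\<lambda>i \<omega>. X i \<omega> + h i) I"
    using ind by (rule indep_vars_compose2) simp
  have D': "distr M (PiM I (\<lambda>_. borel)) (\<lambda>\<omega>. \<lambda>i\<in>I. X i \<omega> + h i) = PiM I N'"
    using ind' I(2) by (subst (asm) indep_vars_iff_distr_eq_PiM') (auto simp: dX' cong: PiM_cong)
  have PN: "PiM I N' = density (PiM I N) (\<lambda>x. \<Prod>i\<in>I. l i (x i))"
    unfolding N' using probN by (intro PiM_density I) (auto simp: N'[symmetric] measurable_cong_sets[OF setsN])
  have setsPN[measurable_cong]: "sets (PiM I N) = sets (PiM I (\<lambda>_. borel))"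
    by (intro sets_PiM_cong setsN refl)
  have "emeasure M {\<omega> \<in> space M. (\<lambda>i\<in>I. X i \<omega> + h i) \<in> B}
      = emeasure (distr M (PiM I (\<lambda>_. borel)) (\<lambda>\<omega>. \<lambda>i\<in>I. X i \<omega> + h i)) B"
    by (subst emeasure_distr) (auto intro!: arg_cong[where f="emeasure M"])
  also have "\<dots> = (\<integral>\<^sup>+x. (\<Prod>i\<in>I. l i (x i)) * indicator B x \<partial>PiM I N)"
    unfolding D' PN by (intro emeasure_density) (auto simp: setsPN)
  also have "\<dots> = (\<integral>\<^sup>+\<omega>. (\<Prod>i\<in>I. l i (X i \<omega>)) * indicator B (\<lambda>i\<in>I. X i \<omega>) \<partial>M)"
    unfolding D[symmetric]
    by (subst nn_integral_distr) auto
  also have "\<dots> = (\<integral>\<^sup>+\<omega>. indicator B (\<lambda>i\<in>I. X i \<omega>)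
          * ennreal (exp ((\<Sum>i\<in>I. h i * X i \<omega> / (s i)\<^sup>2) - (\<Sum>i\<in>I. (h i)\<^sup>2 / (2 * (s i)\<^sup>2)))) \<partial>M)"
    by (intro nn_integral_cong)
       (simp add: l_def prod_ennreal exp_sum[OF I(1), symmetric] sum_subtractf[symmetric] s'_def mult.commute)
  finally show ?thesis .
qed

text \<open>Expanding the square leaves only the diagonal, since independent centred variables are
  uncorrelated.\<close>

lemma indep_vars_second_moment:
  fixes X :: "'i \<Rightarrow> 'a \<Rightarrow> real" and a s :: "'i \<Rightarrow> real"
  assumes I: "finite I"
    and ind: "indep_vars (\<lambda>_. borel) X I"
    and s: "\<And>i. i \<in> I \<Longrightarrow> 0 < s i"
    and X: "\<And>i. i \<in> I \<Longrightarrow> distributed M lborel (X i) (normal_density 0 (s i))"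
  shows "integrable M (\<lambda>\<omega>. (\<Sum>i\<in>I. a i * X i \<omega>)\<^sup>2)"
    and "expectation (\<lambda>\<omega>. (\<Sum>i\<in>I. a i * X i \<omega>)\<^sup>2) = (\<Sum>i\<in>I. (a i * s i)\<^sup>2)"
proof -
  have int1: "integrable M (X i)" and E1: "expectation (X i) = 0" if "i \<in> I" for i
  proof -
    show "integrable M (X i)"
      using distributed_integrable[OF X[OF that], of "\<lambda>x. x"] integrable_normal_moment_nz_1[OF s[OF that], of 0] 
      by simp
    show "expectation (X i) = 0"
      by (rule normal_distributed_expectation[OF s[OF that] X[OF that]])
  qed
  have int2: "integrable M (\<lambda>\<omega>. (X i \<omega>)\<^sup>2)" and E2: "expectation (\<lambda>\<omega>. (X i \<omega>)\<^sup>2) = (s i)\<^sup>2" if "i \<in> I" for i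
  proof -
    show "integrable M (\<lambda>\<omega>. (X i \<omega>)\<^sup>2)"
      using distributed_integrable[OF X[OF that], of "\<lambda>x. x\<^sup>2"] integrable_normal_moment[OF s[OF that], of 0 2] 
      by simp
    show "expectation (\<lambda>\<omega>. (X i \<omega>)\<^sup>2) = (s i)\<^sup>2"
      using normal_distributed_variance[OF s[OF that] X[OF that]] E1[OF that] by simp
  qed
  have pair: "integrable M (\<lambda>\<omega>. X i \<omega> * X j \<omega>) \<and>
      expectation (\<lambda>\<omega>. X i \<omega> * X j \<omega>) = (if i = j then (s i)\<^sup>2 else 0)" if "i \<in> I" "j \<in> I" for i j
  proof (cases "i = j")
    case True
    then show ?thesis using int2 E2 that by (simp add: power2_eq_square)
  next
    case False
    have "indep_vars (\<lambda>_. borel) X {i, j}"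
      using indep_vars_subset[OF ind, of "{i,j}"] that by auto
    then show ?thesis
      using False that int1 E1 indep_vars_lebesgue_integral[of "{i,j}" X] indep_vars_integrable[of "{i,j}" X]
      by auto
  qed
  have eq: "(\<lambda>\<omega>. (\<Sum>i\<in>I. a i * X i \<omega>)\<^sup>2) = (\<lambda>\<omega>. \<Sum>i\<in>I. \<Sum>j\<in>I. a i * a j * (X i \<omega> * X j \<omega>))"
    by (simp add: power2_eq_square sum_product algebra_simps)
  show "integrable M (\<lambda>\<omega>. (\<Sum>i\<in>I. a i * X i \<omega>)\<^sup>2)"
    unfolding eq using pair by (intro Bochner_Integration.integrable_sum) auto
  have "expectation (\<lambda>\<omega>. (\<Sum>i\<in>I. a i * X i \<omega>)\<^sup>2)
      = (\<Sum>i\<in>I. \<Sum>j\<in>I. a i * a j * expectation (\<lambda>\<omega>. X i \<omega> * X j \<omega>))"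
    unfolding eq using pair by (simp add: Bochner_Integration.integral_sum)
  also have "\<dots> = (\<Sum>i\<in>I. \<Sum>j\<in>I. if i = j then (a i * s i)\<^sup>2 else 0)"
    using pair by (intro sum.cong) (auto simp: power2_eq_square)
  also have "\<dots> = (\<Sum>i\<in>I. (a i * s i)\<^sup>2)"
    using I by simp
  finally show "expectation (\<lambda>\<omega>. (\<Sum>i\<in>I. a i * X i \<omega>)\<^sup>2) = (\<Sum>i\<in>I. (a i * s i)\<^sup>2)" .
qed

text \<open>A Jensen-type bound that sees \<open>V\<close> only through its second moment, which
  makes it uniform in the number of Gaussian coordinates.\<close>

lemma exp_neg_abs_expectation_ge:
  fixes V :: "'a \<Rightarrow> real"
  assumes [measurable]: "V \<in> borel_measurable M"
    and int: "integrable M (\<lambda>\<omega>. (V \<omega>)\<^sup>2)" and E: "expectation (\<lambda>\<omega>. (V \<omega>)\<^sup>2) \<le> \<kappa>\<^sup>2" and "\<kappa> > 0"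
  shows "exp (- \<kappa>) \<le> expectation (\<lambda>\<omega>. exp (- \<bar>V \<omega>\<bar>))"
proof -
  \<comment> \<open>tangent line of \<open>exp\<close> at \<open>-\<kappa>\<close>, with \<open>\<bar>V\<bar>\<close> replaced by \<open>V\<^sup>2 / (2 \<kappa>) + \<kappa> / 2\<close>\<close>
  have low: "exp (- \<kappa>) * (1 + \<kappa> / 2 - (V \<omega>)\<^sup>2 / (2 * \<kappa>)) \<le> exp (- \<bar>V \<omega>\<bar>)" for \<omega>
  proof -
    have "0 \<le> (\<bar>V \<omega>\<bar> - \<kappa>)\<^sup>2 / (2 * \<kappa>)" using \<open>\<kappa> > 0\<close> by simp
    also have "\<dots> = (V \<omega>)\<^sup>2 / (2 * \<kappa>) + \<kappa> / 2 - \<bar>V \<omega>\<bar>"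
      using \<open>\<kappa> > 0\<close> by (simp add: power2_diff field_simps power2_eq_square)
    finally have "1 + \<kappa> / 2 - (V \<omega>)\<^sup>2 / (2 * \<kappa>) \<le> 1 + (\<kappa> - \<bar>V \<omega>\<bar>)" by simp
    also have "\<dots> \<le> exp (\<kappa> - \<bar>V \<omega>\<bar>)" by (rule exp_ge_add_one_self)
    finally have "exp (- \<kappa>) * (1 + \<kappa> / 2 - (V \<omega>)\<^sup>2 / (2 * \<kappa>)) \<le> exp (- \<kappa>) * exp (\<kappa> - \<bar>V \<omega>\<bar>)"
      by (intro mult_left_mono) auto
    then show ?thesis by (simp add: exp_add[symmetric])
  qed
  \<comment> \<open>The minorant has mean exactly \<open>exp (- \<kappa>)\<close> when the second
    moment equals \<open>\<kappa>\<^sup>2\<close>; a smaller second moment only raises it.\<close>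
  have "exp (- \<kappa>) = exp (- \<kappa>) * (1 + \<kappa> / 2 - \<kappa>\<^sup>2 / (2 * \<kappa>))"
    using \<open>\<kappa> > 0\<close> by (simp add: power2_eq_square)
  also have "\<dots> \<le> exp (- \<kappa>) * (1 + \<kappa> / 2 - expectation (\<lambda>\<omega>. (V \<omega>)\<^sup>2) / (2 * \<kappa>))"
    using E \<open>\<kappa> > 0\<close> by (intro mult_left_mono diff_left_mono divide_right_mono) auto
  also have "\<dots> = expectation (\<lambda>\<omega>. exp (- \<kappa>) * (1 + \<kappa> / 2 - (V \<omega>)\<^sup>2 / (2 * \<kappa>)))"
    using int by (simp add: prob_space)
  also have "\<dots> \<le> expectation (\<lambda>\<omega>. exp (- \<bar>V \<omega>\<bar>))"
  proof (rule integral_mono)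
    show "integrable M (\<lambda>\<omega>. exp (- \<kappa>) * (1 + \<kappa> / 2 - (V \<omega>)\<^sup>2 / (2 * \<kappa>)))" using int by simp
    show "integrable M (\<lambda>\<omega>. exp (- \<bar>V \<omega>\<bar>))"
      by (rule integrable_const_bound[where B=1]) auto
  qed (rule low)
  finally show ?thesis .
qed

text \<open>The unshifted vector is the midpoint of the two hypotheses, whose densities relative to
  it are \<open>exp (- V - q)\<close> and \<open>exp (V - q)\<close>. The smaller of the two is
  \<open>exp (- \<bar>V\<bar> - q)\<close>, so the sum of the two errors is at least its
  expectation, whatever \<open>B\<close> is.\<close>

lemma normal_shift_two_point_bound:
  fixes X :: "'i \<Rightarrow> 'a \<Rightarrow> real" and h s :: "'i \<Rightarrow> real"
  assumes I: "finite I" "I \<noteq> {}"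
    and ind: "indep_vars (\<lambda>_. borel) X I"
    and s: "\<And>i. i \<in> I \<Longrightarrow> 0 < s i"
    and X: "\<And>i. i \<in> I \<Longrightarrow> distributed M lborel (X i) (normal_density 0 (s i))"
    and B[measurable]: "B \<in> sets (PiM I (\<lambda>_. borel))"
    and \<kappa>: "\<kappa> > 0" "(\<Sum>i\<in>I. (h i / s i)\<^sup>2) \<le> \<kappa>\<^sup>2"
  shows "exp (- \<kappa>\<^sup>2 / 2 - \<kappa>) \<le> prob {\<omega> \<in> space M. (\<lambda>i\<in>I. X i \<omega> - h i) \<in> B}
      + prob {\<omega> \<in> space M. (\<lambda>i\<in>I. X i \<omega> + h i) \<notin> B}"
proof -
  define V where "V \<omega> = (\<Sum>i\<in>I. h i * X i \<omega> / (s i)\<^sup>2)" for \<omega>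
  define q where "q = (\<Sum>i\<in>I. (h i)\<^sup>2 / (2 * (s i)\<^sup>2))"
  define Bc where "Bc = space (PiM I (\<lambda>_. borel)) - B"
  have [measurable]: "Bc \<in> sets (PiM I (\<lambda>_. borel))" by (simp add: Bc_def)
  have X_m[measurable]: "i \<in> I \<Longrightarrow> X i \<in> borel_measurable M" for i
    using X[of i] by (auto simp: distributed_def)
  have [measurable]: "V \<in> borel_measurable M" unfolding V_def by measurable
  \<comment> \<open>\<open>q\<close> is half the variance of \<open>V\<close>, so the normalising
    factor \<open>exp (- q)\<close> costs at most \<open>\<kappa>\<^sup>2 / 2\<close> in the
    exponent.\<close>
  have q: "2 * q = (\<Sum>i\<in>I. (h i / s i)\<^sup>2)"
    unfolding q_def by (simp add: sum_distrib_left power_divide)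
  have Veq: "V \<omega> = (\<Sum>i\<in>I. (h i / (s i)\<^sup>2) * X i \<omega>)" for \<omega> by (simp add: V_def)
  have intV: "integrable M (\<lambda>\<omega>. (V \<omega>)\<^sup>2)"
    unfolding Veq by (rule indep_vars_second_moment[OF I(1) ind s X])
  have "expectation (\<lambda>\<omega>. (V \<omega>)\<^sup>2) = (\<Sum>i\<in>I. (h i / (s i)\<^sup>2 * s i)\<^sup>2)"
    unfolding Veq by (rule indep_vars_second_moment[OF I(1) ind s X])
  also have "\<dots> = (\<Sum>i\<in>I. (h i / s i)\<^sup>2)"
    using s by (intro sum.cong refl) (simp add: power2_eq_square)
  finally have EV: "expectation (\<lambda>\<omega>. (V \<omega>)\<^sup>2) \<le> \<kappa>\<^sup>2" using \<kappa> by simp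
  have P1: "emeasure M {\<omega> \<in> space M. (\<lambda>i\<in>I. X i \<omega> + h i) \<in> Bc}
      = (\<integral>\<^sup>+\<omega>. indicator Bc (\<lambda>i\<in>I. X i \<omega>) * ennreal (exp (V \<omega> - q)) \<partial>M)"
    unfolding V_def q_def by (rule indep_vars_shift_normal[OF I ind s X]) auto
  have P0: "emeasure M {\<omega> \<in> space M. (\<lambda>i\<in>I. X i \<omega> - h i) \<in> B}
      = (\<integral>\<^sup>+\<omega>. indicator B (\<lambda>i\<in>I. X i \<omega>) * ennreal (exp (- V \<omega> - q)) \<partial>M)"
    using indep_vars_shift_normal[OF I ind s X B, of "\<lambda>i. - h i"]
    by (simp add: V_def q_def sum_negf)
  have ne: "{\<omega> \<in> space M. (\<lambda>i\<in>I. X i \<omega> + h i) \<notin> B} = {\<omega> \<in> space M. (\<lambda>i\<in>I. X i \<omega> + h i) \<in> Bc}"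
    by (auto simp: Bc_def space_PiM)
  have "ennreal (exp (- q) * exp (- \<kappa>)) \<le> ennreal (expectation (\<lambda>\<omega>. exp (- q) * exp (- \<bar>V \<omega>\<bar>)))"
    using exp_neg_abs_expectation_ge[OF _ intV EV \<kappa>(1)] by (intro ennreal_leI) simp
  also have "\<dots> = (\<integral>\<^sup>+\<omega>. ennreal (exp (- q) * exp (- \<bar>V \<omega>\<bar>)) \<partial>M)"
    by (intro nn_integral_eq_integral[symmetric] integrable_mult_right
          integrable_const_bound[where B=1]) auto
  also have "\<dots> \<le> (\<integral>\<^sup>+\<omega>. indicator B (\<lambda>i\<in>I. X i \<omega>) * ennreal (exp (- V \<omega> - q))
        + indicator Bc (\<lambda>i\<in>I. X i \<omega>) * ennreal (exp (V \<omega> - q)) \<partial>M)"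
  proof (rule nn_integral_mono)
    fix \<omega>
    \<comment> \<open>Exactly one indicator equals 1, and the density next to it is at least the
      minimum of the two.\<close>
    have "(\<lambda>i\<in>I. X i \<omega>) \<in> B \<or> (\<lambda>i\<in>I. X i \<omega>) \<in> Bc"
      by (auto simp: Bc_def space_PiM)
    then show "ennreal (exp (- q) * exp (- \<bar>V \<omega>\<bar>))
      \<le> indicator B (\<lambda>i\<in>I. X i \<omega>) * ennreal (exp (- V \<omega> - q))
        + indicator Bc (\<lambda>i\<in>I. X i \<omega>) * ennreal (exp (V \<omega> - q))"
      by (auto simp: Bc_def exp_add[symmetric] indicator_def intro!: ennreal_leI)
  qed
  also have "\<dots> = emeasure M {\<omega> \<in> space M. (\<lambda>i\<in>I. X i \<omega> - h i) \<in> B}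
      + emeasure M {\<omega> \<in> space M. (\<lambda>i\<in>I. X i \<omega> + h i) \<in> Bc}"
    unfolding P0 P1 by (rule nn_integral_add) auto
  also have "\<dots> = ennreal (prob {\<omega> \<in> space M. (\<lambda>i\<in>I. X i \<omega> - h i) \<in> B}
      + prob {\<omega> \<in> space M. (\<lambda>i\<in>I. X i \<omega> + h i) \<in> Bc})"
    by (simp add: emeasure_eq_measure ennreal_plus)
  finally have "exp (- q) * exp (- \<kappa>) \<le> prob {\<omega> \<in> space M. (\<lambda>i\<in>I. X i \<omega> - h i) \<in> B}
      + prob {\<omega> \<in> space M. (\<lambda>i\<in>I. X i \<omega> + h i) \<notin> B}"
    unfolding ne by (subst (asm) ennreal_le_iff) auto
  moreover have "exp (- \<kappa>\<^sup>2 / 2 - \<kappa>) \<le> exp (- q) * exp (- \<kappa>)"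
    using q \<kappa> by (simp add: exp_add[symmetric])
  ultimately show ?thesis by linarith
qed

end

section \<open>Approximation by cylinder events\<close>

text \<open>The events that can be approximated form a sigma-algebra containing \<open>\<C>\<close>.
  A single \<open>C\<close> serves both measures, since a test is judged by its errors under both
  hypotheses at once.\<close>

lemma algebra_approximation:
  assumes alg: "algebra \<Omega> \<C>"
    and fin: "finite_measure N0" "finite_measure N1"
    and sets: "sets N0 = sigma_sets \<Omega> \<C>" "sets N1 = sigma_sets \<Omega> \<C>"
    and E: "E \<in> sigma_sets \<Omega> \<C>" and "\<delta> > 0"
  obtains C where "C \<in> \<C>" "measure N0 (sym_diff E C) < \<delta>" "measure N1 (sym_diff E C) < \<delta>"
proof -
  interpret algebra \<Omega> \<C> by fact
  interpret N0: finite_measure N0 by fact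
  interpret N1: finite_measure N1 by fact
  have sp: "space N0 = \<Omega>" "space N1 = \<Omega>"
    using sets sets_eq_imp_space_eq[of N0 "sigma \<Omega> \<C>"] sets_eq_imp_space_eq[of N1 "sigma \<Omega> \<C>"] space_closed
    by (simp_all add: sets_measure_of space_measure_of)
  have sub: "C \<in> sigma_sets \<Omega> \<C>" if "C \<in> \<C>" for C using that by auto
  have "\<forall>\<delta>>0. \<exists>C\<in>\<C>. measure N0 (sym_diff E C) < \<delta> \<and> measure N1 (sym_diff E C) < \<delta>"
    using E
  proof (induction rule: sigma_sets.induct)
    case (Basic a)
    then show ?case by (intro allI impI bexI[of _ a]) auto
  next
    case Empty
    then show ?case by (intro allI impI bexI[of _ "{}"]) auto
  next
    case (Compl a)
    have "a \<subseteq> \<Omega>" using Compl.hyps sp sets sets.sets_into_space[of a N0] by auto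
    show ?case
    proof (intro allI impI)
      fix \<delta> :: real assume "\<delta> > 0"
      with Compl.IH obtain C where C: "C \<in> \<C>" "measure N0 (sym_diff a C) < \<delta>" "measure N1 (sym_diff a C) < \<delta>"
        by blast
      have "sym_diff (\<Omega> - a) (\<Omega> - C) = sym_diff a C"
        using \<open>a \<subseteq> \<Omega>\<close> C(1) sets_into_space by blast
      with C show "\<exists>C\<in>\<C>. measure N0 (sym_diff (\<Omega> - a) C) < \<delta> \<and> measure N1 (sym_diff (\<Omega> - a) C) < \<delta>"
        by (intro bexI[of _ "\<Omega> - C"]) auto
    qed
  next
    case (Union a)
    show ?case
    proof (intro allI impI)
      fix \<delta> :: real assume "\<delta> > 0"
      \<comment> \<open>A finite union captures all but \<open>\<delta>/2\<close> of the mass under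
        both measures; the other \<open>\<delta>/2\<close> is spent on approximating its finitely
        many members.\<close>
      define U where "U k = (\<Union>i<k. a i)" for k :: nat
      have a: "a i \<in> sets N0" "a i \<in> sets N1" for i using Union.hyps sets by auto
      have U: "U k \<in> sets N0" "U k \<in> sets N1" for k using a by (auto simp: U_def)
      have "incseq U" by (auto simp: U_def incseq_def intro!: less_le_trans)
      have UN: "(\<Union>k. U k) = (\<Union>i. a i)" by (auto simp: U_def)
      have "(\<lambda>k. measure N0 (U k)) \<longlonglongrightarrow> measure N0 (\<Union>i. a i)"
        using N0.finite_Lim_measure_incseq[of U] U \<open>incseq U\<close> by (auto simp: UN)
      from order_tendstoD(1)[OF this, of "measure N0 (\<Union>i. a i) - \<delta>/2"] \<open>\<delta> > 0\<close>
      have ev0: "\<forall>\<^sub>F k in sequentially. measure N0 (\<Union>i. a i) - \<delta>/2 < measure N0 (U k)" by simp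
      have "(\<lambda>k. measure N1 (U k)) \<longlonglongrightarrow> measure N1 (\<Union>i. a i)"
        using N1.finite_Lim_measure_incseq[of U] U \<open>incseq U\<close> by (auto simp: UN)
      from order_tendstoD(1)[OF this, of "measure N1 (\<Union>i. a i) - \<delta>/2"] \<open>\<delta> > 0\<close>
      have "\<forall>\<^sub>F k in sequentially. measure N1 (\<Union>i. a i) - \<delta>/2 < measure N1 (U k)" by simp
      with ev0 obtain k where k: "measure N0 (\<Union>i. a i) - \<delta>/2 < measure N0 (U k)"
          "measure N1 (\<Union>i. a i) - \<delta>/2 < measure N1 (U k)"
        using eventually_happens'[OF sequentially_bot eventually_conj] by blast
      \<comment> \<open>Dividing by \<open>k + 1\<close> instead of \<open>k\<close> keeps
        \<open>\<eta>\<close> positive when \<open>k = 0\<close>.\<close>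
      define \<eta> where "\<eta> = \<delta> / (2 * (k + 1))"
      have "\<eta> > 0" using \<open>\<delta> > 0\<close> by (simp add: \<eta>_def)
      have \<eta>: "k * \<eta> \<le> \<delta> / 2" using \<open>\<delta> > 0\<close> by (simp add: \<eta>_def field_simps)
      have "\<forall>i. \<exists>C\<in>\<C>. measure N0 (sym_diff (a i) C) < \<eta> \<and> measure N1 (sym_diff (a i) C) < \<eta>"
        using Union.IH \<open>\<eta> > 0\<close> by blast
      then obtain C where C: "\<And>i. C i \<in> \<C>" "\<And>i. measure N0 (sym_diff (a i) (C i)) < \<eta>"
          "\<And>i. measure N1 (sym_diff (a i) (C i)) < \<eta>" by metis
      have Csets: "C i \<in> sets N0" "C i \<in> sets N1" for i using C(1) sub sets by auto
      define D where "D = (\<Union>i<k. C i)"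
      have "D \<in> \<C>" unfolding D_def using C(1) by (intro finite_UN) auto
      have cover: "sym_diff (\<Union>i. a i) D \<subseteq> ((\<Union>i. a i) - U k) \<union> (\<Union>i<k. sym_diff (a i) (C i))"
        unfolding D_def U_def by blast
      have bound: "measure N (sym_diff (\<Union>i. a i) D) < \<delta>"
        if "finite_measure N" and s: "\<And>i. a i \<in> sets N" "\<And>i. C i \<in> sets N" "\<And>k. U k \<in> sets N"
          and m: "\<And>i. measure N (sym_diff (a i) (C i)) < \<eta>"
          and kN: "measure N (\<Union>i. a i) - \<delta>/2 < measure N (U k)" for N
      proof -
        interpret N: finite_measure N by fact
        have "measure N (sym_diff (\<Union>i. a i) D)
            \<le> measure N (((\<Union>i. a i) - U k) \<union> (\<Union>i<k. sym_diff (a i) (C i)))"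
          using s by (intro N.finite_measure_mono cover) auto
        also have "\<dots> \<le> measure N ((\<Union>i. a i) - U k) + measure N (\<Union>i<k. sym_diff (a i) (C i))"
          using s by (intro measure_Un_le) auto
        also have "measure N ((\<Union>i. a i) - U k) = measure N (\<Union>i. a i) - measure N (U k)"
          using s by (intro N.finite_measure_Diff) (auto simp: U_def)
        also have "measure N (\<Union>i<k. sym_diff (a i) (C i)) \<le> (\<Sum>i<k. measure N (sym_diff (a i) (C i)))"
          using s by (intro N.finite_measure_subadditive_finite) auto
        also have "\<dots> \<le> (\<Sum>i<k. \<eta>)" using m by (intro sum_mono) (auto intro: less_imp_le)
        finally show ?thesis using kN \<eta> by simp
      qed
      show "\<exists>C\<in>\<C>. measure N0 (sym_diff (\<Union>i. a i) C) < \<delta> \<and> measure N1 (sym_diff (\<Union>i. a i) C) < \<delta>"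
        using \<open>D \<in> \<C>\<close> bound[OF fin(1) a(1) Csets(1) U(1) C(2) k(1)]
          bound[OF fin(2) a(2) Csets(2) U(2) C(3) k(2)] by blast
    qed
  qed
  then show ?thesis using \<open>\<delta> > 0\<close> that by blast
qed

text \<open>Finite-dimensional cylinders form an algebra generating the product sigma-algebra, so
  \<open>algebra_approximation\<close> reduces an event on paths to finitely many observation
  times.\<close>

lemma PiM_cylinder_approximation:
  fixes I :: "'i set" and E :: "('i \<Rightarrow> real) set"
  assumes fin: "finite_measure N0" "finite_measure N1"
    and sets: "sets N0 = sets (PiM I (\<lambda>_. borel))" "sets N1 = sets (PiM I (\<lambda>_. borel))"
    and E: "E \<in> sets (PiM I (\<lambda>_. borel))" and "\<delta> > 0"
  obtains J B where "finite J" "J \<subseteq> I" "B \<in> sets (PiM J (\<lambda>_. borel))"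
    "measure N0 (sym_diff E (prod_emb I (\<lambda>_. borel) J B)) < \<delta>"
    "measure N1 (sym_diff E (prod_emb I (\<lambda>_. borel) J B)) < \<delta>"
proof -
  \<comment> \<open>a dummy measure, only to reuse the library's algebra of cylinder sets\<close>
  interpret R: product_prob_space "\<lambda>_. return borel (0::real)" I
    by (rule product_prob_spaceI) (simp add: prob_space_return)
  have seq: "sets (PiM J (\<lambda>_. return borel (0::real))) = sets (PiM J (\<lambda>_. borel))" for J :: "'i set"
    by (intro sets_PiM_cong) auto
  have gen: "sets (PiM I (\<lambda>_. borel)) = sigma_sets (space (PiM I (\<lambda>_. return borel (0::real)))) R.generator"
    using R.sets_PiM_generator by (simp add: seq)
  obtain C where C: "C \<in> R.generator" "measure N0 (sym_diff E C) < \<delta>" "measure N1 (sym_diff E C) < \<delta>"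
    using algebra_approximation[OF R.algebra_generator fin, of E \<delta>] sets E \<open>\<delta> > 0\<close> gen by metis
  from C(1) obtain J B where "finite J" "J \<subseteq> I" "B \<in> sets (PiM J (\<lambda>_. borel))"
      "C = prod_emb I (\<lambda>_. borel) J B"
    by (cases rule: R.generator.cases) (auto simp: seq prod_emb_def)
  with C(2,3) show ?thesis by (auto intro: that)
qed

section \<open>Drift increments\<close>

text \<open>The deterministic part of \<open>observation\<close>, kept in the same form so that the
  two unfold to each other.\<close>

definition drift :: "(real \<Rightarrow> real) \<Rightarrow> real \<Rightarrow> real" where
  "drift f t = integral\<^sup>L (lebesgue_on {0<..<t}) f"

lemma integrable_const_unit: "integrable (lebesgue_on {0<..<1::real}) (\<lambda>_. c :: real)"
  by (intro finite_measure.integrable_const finite_measure_lebesgue_on) auto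

lemma L2_unit_integrable:
  assumes "f \<in> L2_unit"
  shows "integrable (lebesgue_on {0<..<1}) f"
proof (rule Bochner_Integration.integrable_bound)
  show "integrable (lebesgue_on {0<..<1::real}) (\<lambda>t. 1 + (f t)\<^sup>2)"
    using assms integrable_const_unit by (auto simp: L2_unit_def)
  have "\<bar>x\<bar> \<le> 1 + x\<^sup>2" for x :: real
    using zero_le_power2[of "\<bar>x\<bar> - 1"] unfolding power2_diff power2_abs by simp
  then show "AE t in lebesgue_on {0<..<1}. norm (f t) \<le> norm (1 + (f t)\<^sup>2)"
    by simp
qed (use assms in \<open>auto simp: L2_unit_def\<close>)

lemma L2_unit_linear:
  assumes f: "f \<in> L2_unit" and g: "g \<in> L2_unit"
  shows "(\<lambda>t. a * f t + b * g t) \<in> L2_unit"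
proof -
  have [measurable]: "f \<in> borel_measurable (lebesgue_on {0<..<1})" "g \<in> borel_measurable (lebesgue_on {0<..<1})"
    using f g by (auto simp: L2_unit_def)
  have "integrable (lebesgue_on {0<..<1}) (\<lambda>t. (a * f t + b * g t)\<^sup>2)"
  proof (rule Bochner_Integration.integrable_bound)
    show "integrable (lebesgue_on {0<..<1}) (\<lambda>t. 2 * a\<^sup>2 * (f t)\<^sup>2 + 2 * b\<^sup>2 * (g t)\<^sup>2)"
      using f g by (auto simp: L2_unit_def)
    have "(x + y)\<^sup>2 \<le> 2 * x\<^sup>2 + 2 * y\<^sup>2" for x y :: real
      using zero_le_power2[of "x - y"] by (simp add: power2_eq_square algebra_simps)
    from this[of "a * f t" "b * g t" for t]
    show "AE t in lebesgue_on {0<..<1}. norm ((a * f t + b * g t)\<^sup>2) \<le> norm (2 * a\<^sup>2 * (f t)\<^sup>2 + 2 * b\<^sup>2 * (g t)\<^sup>2)"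
      by (simp add: power_mult_distrib mult.assoc)
  qed measurable
  then show ?thesis by (auto simp: L2_unit_def)
qed

lemma integrable_indicator_mult_unit:
  fixes f :: "real \<Rightarrow> real"
  assumes "integrable (lebesgue_on {0<..<1}) f" "A \<in> sets borel"
  shows "integrable (lebesgue_on {0<..<1}) (\<lambda>s. indicator A s * f s)"
proof -
  have "A \<inter> {0<..<1} \<in> sets (lebesgue_on {0<..<1})"
    using assms(2) by (auto simp: sets_restrict_space)
  then have "integrable (lebesgue_on {0<..<1}) (\<lambda>s. indicator (A \<inter> {0<..<1}) s *\<^sub>R f s)"
    using assms(1) by (rule integrable_mult_indicator)
  then show ?thesis
    by (rule Bochner_Integration.integrable_cong[THEN iffD1, rotated -1]) (auto simp: indicator_def)
qed

text \<open>Moves all upper limits \<open>t\<close> onto one measure space. Half-lines open on the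
  right are used so that the difference of two indicators is exactly the indicator of
  \<open>{a..<b}\<close>.\<close>

lemma drift_eq:
  assumes "t \<le> 1"
  shows "drift f t = (LINT s|lebesgue_on {0<..<1}. indicator {..<t} s * f s)"
proof -
  have "drift f t = (LINT s|lebesgue. indicator {0<..<t} s *\<^sub>R f s)"
    unfolding drift_def by (subst integral_restrict_space) auto
  also have "\<dots> = (LINT s|lebesgue. indicator {0<..<1} s *\<^sub>R (indicator {..<t} s * f s))"
    using assms by (intro Bochner_Integration.integral_cong) (auto simp: indicator_def)
  also have "\<dots> = (LINT s|lebesgue_on {0<..<1}. indicator {..<t} s * f s)"
    by (subst integral_restrict_space) auto
  finally show ?thesis .
qed

lemma drift_0 [simp]: "drift f 0 = 0"
  by (simp add: drift_eq drift_def integral_restrict_space)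

lemma drift_diff_eq:
  assumes f: "integrable (lebesgue_on {0<..<1}) f" and "a \<le> b" "b \<le> 1"
  shows "drift f b - drift f a = (LINT s|lebesgue_on {0<..<1}. indicator {a..<b} s * f s)"
proof -
  have "drift f b - drift f a
      = (LINT s|lebesgue_on {0<..<1}. indicator {..<b} s * f s - indicator {..<a} s * f s)"
    using assms by (simp add: drift_eq integrable_indicator_mult_unit)
  also have "\<dots> = (LINT s|lebesgue_on {0<..<1}. indicator {a..<b} s * f s)"
    using assms by (intro Bochner_Integration.integral_cong) (auto simp: indicator_def)
  finally show ?thesis .
qed

lemma drift_subtract:
  assumes "f \<in> L2_unit" "g \<in> L2_unit" "t \<le> 1"
  shows "drift (\<lambda>s. f s - g s) t = drift f t - drift g t"
  using assms by (simp add: drift_eq right_diff_distrib L2_unit_integrable integrable_indicator_mult_unit)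

text \<open>The energy of one increment is bounded by the energy of \<open>f\<close> on the same
  interval. The right side is written as an increment of \<open>drift\<close>, so that sums over a
  partition telescope.\<close>

lemma drift_increment_sq_le:
  assumes f: "f \<in> L2_unit" and ab: "0 \<le> a" "a < b" "b \<le> 1"
  shows "(drift f b - drift f a)\<^sup>2 / (b - a) \<le> drift (\<lambda>t. (f t)\<^sup>2) b - drift (\<lambda>t. (f t)\<^sup>2) a"
proof -
  let ?N = "lebesgue_on {0<..<1::real}"
  define m where "m = drift f b - drift f a"
  define c where "c = m / (b - a)"
  have i1: "integrable ?N f" using f by (rule L2_unit_integrable)
  have i2: "integrable ?N (\<lambda>t. (f t)\<^sup>2)" using f by (simp add: L2_unit_def)
  have m: "(LINT s|?N. indicator {a..<b} s * f s) = m"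
    using drift_diff_eq[OF i1, of a b] ab by (simp add: m_def)
  have ind: "(LINT s|?N. indicator {a..<b} s) = b - a"
  proof -
    have "(LINT s|?N. indicator {a..<b} s) = (LINT s|lebesgue. indicator {0<..<1} s *\<^sub>R (indicator {a..<b} s :: real))"
      by (rule integral_restrict_space) auto
    \<comment> \<open>Intersecting with the open unit interval removes the left endpoint exactly
      when \<open>a = 0\<close>; the right endpoint is already excluded.\<close>
    also have "\<dots> = (LINT s|lebesgue. indicator (if a = 0 then {a<..<b} else {a..<b}) s)"
      using ab by (intro Bochner_Integration.integral_cong) (auto simp: indicator_def)
    also have "\<dots> = b - a"
      using ab by simp
    finally show ?thesis .
  qed
  have j0: "integrable ?N (\<lambda>s. indicator {a..<b} s :: real)"
    using integrable_indicator_mult_unit[OF integrable_const_unit[of 1], of "{a..<b}"] by simp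
  note j1 = integrable_indicator_mult_unit[OF i1, of "{a..<b}"]
  note j2 = integrable_indicator_mult_unit[OF i2, of "{a..<b}"]
  \<comment> \<open>Cauchy-Schwarz as nonnegativity of the variance of \<open>f\<close> over \<open>[a, b)\<close>\<close>
  have "0 \<le> (LINT s|?N. indicator {a..<b} s * (f s - c)\<^sup>2)"
    by (intro Bochner_Integration.integral_nonneg) auto
  also have "\<dots> = (LINT s|?N. indicator {a..<b} s * (f s)\<^sup>2 - 2 * c * (indicator {a..<b} s * f s)
      + c\<^sup>2 * indicator {a..<b} s)"
    by (intro Bochner_Integration.integral_cong) (auto simp: power2_diff algebra_simps)
  also have "\<dots> = (LINT s|?N. indicator {a..<b} s * (f s)\<^sup>2) - 2 * c * m + c\<^sup>2 * (b - a)"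
    using j0 j1 j2 ind by (simp add: m)
  also have "(LINT s|?N. indicator {a..<b} s * (f s)\<^sup>2) = drift (\<lambda>t. (f t)\<^sup>2) b - drift (\<lambda>t. (f t)\<^sup>2) a"
    using drift_diff_eq[OF i2, of a b] ab by simp
  finally have "2 * c * m - c\<^sup>2 * (b - a) \<le> drift (\<lambda>t. (f t)\<^sup>2) b - drift (\<lambda>t. (f t)\<^sup>2) a" by simp
  moreover have "c * (b - a) = m" using ab by (simp add: c_def)
  then have "c\<^sup>2 * (b - a) = c * m" by (simp add: power2_eq_square mult.assoc)
  then have "2 * c * m - c\<^sup>2 * (b - a) = m\<^sup>2 / (b - a)"
    by (simp add: c_def power2_eq_square)
  ultimately show ?thesis by (simp add: m_def)
qed

lemma drift_nonneg_mono:
  assumes f: "integrable (lebesgue_on {0<..<1}) f" "\<And>t. 0 \<le> f t" and ab: "a \<le> b" "b \<le> 1"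
  shows "drift f a \<le> drift f b"
proof -
  have "0 \<le> drift f b - drift f a"
    unfolding drift_diff_eq[OF f(1) ab] using f(2) by (intro Bochner_Integration.integral_nonneg) auto
  then show ?thesis by simp
qed

text \<open>A Bessel inequality: the left side is the squared norm of the projection of
  \<open>f\<close> onto step functions of the partition. The bound is the same for every partition,
  which is what permits the passage from cylinders to all events.\<close>

lemma drift_increment_sum_le:
  assumes f: "f \<in> L2_unit" and \<tau>: "strict_mono_on {..n} \<tau>" "\<tau> ` {..n} \<subseteq> {0..1}"
  shows "(\<Sum>i<n. (drift f (\<tau> (Suc i)) - drift f (\<tau> i))\<^sup>2 / (\<tau> (Suc i) - \<tau> i))
    \<le> (LINT t|lebesgue_on {0<..<1}. (f t)\<^sup>2)"
proof -
  let ?G = "drift (\<lambda>t. (f t)\<^sup>2)"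
  have i2: "integrable (lebesgue_on {0<..<1}) (\<lambda>t. (f t)\<^sup>2)" using f by (simp add: L2_unit_def)
  have rng: "0 \<le> \<tau> i" "\<tau> i \<le> 1" if "i \<le> n" for i using \<tau>(2) that by auto
  have "(\<Sum>i<n. (drift f (\<tau> (Suc i)) - drift f (\<tau> i))\<^sup>2 / (\<tau> (Suc i) - \<tau> i))
      \<le> (\<Sum>i<n. ?G (\<tau> (Suc i)) - ?G (\<tau> i))"
    using \<tau>(1) rng by (intro sum_mono drift_increment_sq_le[OF f]) (auto simp: strict_mono_on_def)
  also have "\<dots> = ?G (\<tau> n) - ?G (\<tau> 0)" by (rule sum_lessThan_telescope)
  also have "\<dots> \<le> ?G 1 - ?G 0"
    using rng[of 0] rng[of n] by (intro diff_mono drift_nonneg_mono i2) auto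
  also have "\<dots> = (LINT t|lebesgue_on {0<..<1}. (f t)\<^sup>2)" by (simp add: drift_def[of _ 1])
  finally show ?thesis .
qed

text \<open>By Cauchy-Schwarz the drift is Hoelder continuous of order 1/2. This places the observed
  paths in \<open>path_space\<close>.\<close>

lemma drift_continuous:
  assumes f: "f \<in> L2_unit"
  shows "continuous_on {0..1} (drift f)"
proof -
  let ?G = "drift (\<lambda>t. (f t)\<^sup>2)"
  define K where "K = ?G 1"
  have i2: "integrable (lebesgue_on {0<..<1}) (\<lambda>t. (f t)\<^sup>2)" using f by (simp add: L2_unit_def)
  have G: "0 \<le> ?G t" "?G t \<le> K" if "t \<in> {0..1}" for t
    using drift_nonneg_mono[OF i2, of 0 t] drift_nonneg_mono[OF i2, of t 1] that by (auto simp: K_def)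
  have "K \<ge> 0" using G[of 1] by simp
  have lt: "(drift f b - drift f a)\<^sup>2 \<le> K * (b - a)" if "a \<in> {0..1}" "b \<in> {0..1}" "a < b" for a b
  proof -
    have "(drift f b - drift f a)\<^sup>2 / (b - a) \<le> K"
      using drift_increment_sq_le[OF f, of a b] G[of a] G[of b] that by auto
    then show ?thesis using that by (simp add: field_simps)
  qed
  have hol: "(drift f b - drift f a)\<^sup>2 \<le> K * \<bar>b - a\<bar>" if "a \<in> {0..1}" "b \<in> {0..1}" for a b
    using lt[of a b] lt[of b a] that by (cases a b rule: linorder_cases) (auto simp: power2_commute)
  have "continuous (at a within {0..1}) (drift f)" if a: "a \<in> {0..1}" for a
  proof -
    have "((\<lambda>b. (drift f b - drift f a)\<^sup>2) \<longlongrightarrow> 0) (at a within {0..1})"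
    proof (rule tendsto_sandwich[OF _ _ tendsto_const])
      show "((\<lambda>b. K * \<bar>b - a\<bar>) \<longlongrightarrow> 0) (at a within {0..1})"
        by (rule tendsto_eq_intros refl | simp)+
      show "\<forall>\<^sub>F b in at a within {0..1}. (drift f b - drift f a)\<^sup>2 \<le> K * \<bar>b - a\<bar>"
        using hol a by (auto simp: eventually_at_filter)
    qed auto
    then have "((\<lambda>b. drift f b - drift f a) \<longlongrightarrow> 0) (at a within {0..1})"
      by simp
    then show ?thesis by (simp add: continuous_within LIM_zero_iff)
  qed
  then show ?thesis by (simp add: continuous_on_eq_continuous_within)
qed

section \<open>Two-point bound on path space\<close>

lemma observation_eq:
  "observation w S \<epsilon> \<theta> \<omega> = (\<lambda>t\<in>{0..1}. drift (\<lambda>s. S s \<theta>) t + \<epsilon> * w t \<omega>)"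
  by (simp add: observation_def drift_def)

lemma measurable_observation_PiM:
  assumes "wiener_process M w"
  shows "observation w S \<epsilon> \<theta> \<in> measurable M (PiM {0..1} (\<lambda>_. borel))"
  unfolding observation_eq using assms
  by (intro measurable_restrict borel_measurable_add borel_measurable_times)
     (auto simp: wiener_process_def)

lemma measurable_observation:
  assumes w: "wiener_process M w" and S: "(\<lambda>t. S t \<theta>) \<in> L2_unit"
  shows "observation w S \<epsilon> \<theta> \<in> measurable M path_space"
  unfolding path_space_def
proof (rule measurable_restrict_space2[OF _ measurable_observation_PiM[OF w]], intro funcsetI CollectI)
  fix \<omega> assume "\<omega> \<in> space M"
  then have "continuous_on {0..1} (\<lambda>t. drift (\<lambda>s. S s \<theta>) t + \<epsilon> * w t \<omega>)"
    using w drift_continuous[OF S] by (auto intro!: continuous_intros simp: wiener_process_def)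
  then show "continuous_on {0..1} (observation w S \<epsilon> \<theta> \<omega>)"
    unfolding observation_eq by (rule continuous_on_eq) simp
qed

text \<open>The observation at the times in \<open>J\<close> is a function of independent Gaussian
  increments. After recentring at the average drift, the two hypotheses become the shifts by
  \<open>- h\<close> and \<open>h\<close> of one Gaussian vector, and the Bessel inequality controls
  the size of \<open>h\<close>.\<close>

lemma (in prob_space) cylinder_two_point_bound:
  assumes w: "wiener_process M w"
    and S: "(\<lambda>t. S t \<theta>\<^sub>0) \<in> L2_unit" "(\<lambda>t. S t \<theta>\<^sub>1) \<in> L2_unit"
    and \<epsilon>: "\<epsilon> > 0" and \<kappa>: "\<kappa> > 0"
    and dist: "(LINT t|lebesgue_on {0<..<1}. (S t \<theta>\<^sub>1 - S t \<theta>\<^sub>0)\<^sup>2) \<le> (2 * \<epsilon> * \<kappa>)\<^sup>2"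
    and J: "finite J" "J \<subseteq> {0..1}" and B[measurable]: "B \<in> sets (PiM J (\<lambda>_. borel))"
  shows "exp (- \<kappa>\<^sup>2 / 2 - \<kappa>) \<le> prob {\<omega> \<in> space M. restrict (observation w S \<epsilon> \<theta>\<^sub>0 \<omega>) J \<in> B}
      + prob {\<omega> \<in> space M. restrict (observation w S \<epsilon> \<theta>\<^sub>1 \<omega>) J \<notin> B}"
proof -
  \<comment> \<open>The time 0 anchors the partial sums, as \<open>w\<close> and the drift vanish
    there; the time 1 guarantees at least one increment even when \<open>J\<close> is empty.\<close>
  define K where "K = J \<union> {0, 1}"
  have K: "finite K" "K \<subseteq> {0..1}" "0 \<in> K" "1 \<in> K" using J by (auto simp: K_def)
  define \<tau> where "\<tau> i = sorted_list_of_set K ! i" for i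
  have \<tau>: "\<tau> ` {..<card K} = K" "strict_mono_on {..<card K} \<tau>"
  proof -
    have "\<tau> ` {..<card K} = set (sorted_list_of_set K)"
      unfolding \<tau>_def using set_conv_nth[of "sorted_list_of_set K"] by (auto simp: image_def)
    then show "\<tau> ` {..<card K} = K" using K by simp
    show "strict_mono_on {..<card K} \<tau>"
      unfolding \<tau>_def by (intro strict_mono_onI) (simp add: sorted_wrt_nth_less[OF strict_sorted_list_of_set])
  qed
  define n where "n = card K - 1"
  have "card {0, 1::real} \<le> card K" using K by (intro card_mono) auto
  then have n: "n \<ge> 1" "{..<card K} = {..n}" by (auto simp: n_def)
  have \<tau>_mono: "strict_mono_on {..n} \<tau>" and \<tau>_img: "\<tau> ` {..n} = K"
    using \<tau> n(2) by auto
  have \<tau>_rng: "\<tau> ` {..n} \<subseteq> {0..1}" using \<tau>_img K by simp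
  have \<tau>_less: "0 \<le> \<tau> i \<and> \<tau> i < \<tau> (Suc i) \<and> \<tau> (Suc i) \<le> 1" if "i < n" for i
  proof -
    have "i \<in> {..n}" "Suc i \<in> {..n}" using that by auto
    then show ?thesis using \<tau>_mono \<tau>_rng
      by (meson atLeastAtMost_iff image_subset_iff lessI strict_mono_onD)
  qed
  have \<tau>0: "\<tau> 0 = 0"
  proof -
    obtain k where k: "k \<le> n" "\<tau> k = 0" using \<tau>_img K(3) by (metis atMost_iff imageE)
    have "0 \<le> \<tau> 0" using \<tau>_rng by auto
    moreover have "\<tau> 0 < \<tau> k" if "k > 0" using \<tau>_mono k that by (intro strict_mono_onD[OF \<tau>_mono]) auto
    ultimately show ?thesis using k by (cases "k = 0") auto
  qed
  have "\<exists>k\<le>n. \<tau> k = t" if "t \<in> J" for t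
  proof -
    have "t \<in> \<tau> ` {..n}" using \<tau>_img that by (simp add: K_def)
    then show ?thesis by auto
  qed
  then obtain k where k: "\<And>t. t \<in> J \<Longrightarrow> k t \<le> n \<and> \<tau> (k t) = t" by metis
  define F where "F \<theta> = drift (\<lambda>s. S s \<theta>)" for \<theta>
  define X where "X i \<omega> = w (\<tau> (Suc i)) \<omega> - w (\<tau> i) \<omega>" for i \<omega>
  define m where "m \<theta> i = F \<theta> (\<tau> (Suc i)) - F \<theta> (\<tau> i)" for \<theta> i
  \<comment> \<open>Chosen together with \<open>c\<close> so that the drift increments are
    \<open>c i - \<epsilon> * h i\<close> under \<open>\<theta>\<^sub>0\<close> and
    \<open>c i + \<epsilon> * h i\<close> under \<open>\<theta>\<^sub>1\<close>.\<close>
  define h where "h i = (m \<theta>\<^sub>1 i - m \<theta>\<^sub>0 i) / (2 * \<epsilon>)" for i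
  define c where "c i = (m \<theta>\<^sub>0 i + m \<theta>\<^sub>1 i) / 2" for i
  define s where "s i = sqrt (\<tau> (Suc i) - \<tau> i)" for i
  \<comment> \<open>Rebuilds the values at the times in \<open>J\<close> from recentred increments.
    The same map serves both hypotheses, so the event \<open>B\<close> pulls back to a single event
    \<open>B'\<close>.\<close>
  define \<psi> where "\<psi> z = (\<lambda>t\<in>J. \<Sum>i<k t. c i + \<epsilon> * z i)" for z :: "nat \<Rightarrow> real"
  define B' where "B' = \<psi> -` B \<inter> space (PiM {..<n} (\<lambda>_. borel))"
  have [measurable]: "\<psi> \<in> measurable (PiM {..<n} (\<lambda>_. borel)) (PiM J (\<lambda>_. borel))"
    unfolding \<psi>_def
  proof (intro measurable_restrict borel_measurable_sum borel_measurable_add borel_measurable_times borel_measurable_const)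
    fix t i assume "t \<in> J" "i \<in> {..<k t}"
    then show "(\<lambda>z. z i) \<in> borel_measurable (PiM {..<n} (\<lambda>_. borel))"
      using k[of t] by (intro measurable_component_singleton) auto
  qed
  have B': "B' \<in> sets (PiM {..<n} (\<lambda>_. borel))" unfolding B'_def by measurable
  have obs: "restrict (observation w S \<epsilon> \<theta> \<omega>) J = (\<lambda>t\<in>J. \<Sum>i<k t. m \<theta> i + \<epsilon> * X i \<omega>)"
    if "\<omega> \<in> space M" for \<theta> \<omega>
  proof (rule restrict_ext)
    fix t assume t: "t \<in> J"
    have "(\<Sum>i<k t. m \<theta> i + \<epsilon> * X i \<omega>) = (\<Sum>i<k t. m \<theta> i) + \<epsilon> * (\<Sum>i<k t. X i \<omega>)"
      by (simp add: sum.distrib sum_distrib_left)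
    also have "(\<Sum>i<k t. m \<theta> i) = F \<theta> t"
      unfolding m_def using k[OF t] \<tau>0
      by (subst sum_lessThan_telescope[of "\<lambda>i. F \<theta> (\<tau> i)"]) (simp add: F_def)
    also have "(\<Sum>i<k t. X i \<omega>) = w t \<omega>"
      unfolding X_def using k[OF t] \<tau>0 w that
      by (subst sum_lessThan_telescope[of "\<lambda>i. w (\<tau> i) \<omega>"]) (simp add: wiener_process_def)
    finally show "observation w S \<epsilon> \<theta> \<omega> t = (\<Sum>i<k t. m \<theta> i + \<epsilon> * X i \<omega>)"
      using t J by (auto simp: observation_eq F_def)
  qed
  have \<psi>_restrict: "\<psi> (\<lambda>i\<in>{..<n}. z i) = \<psi> z" for z
    unfolding \<psi>_def by (intro restrict_ext sum.cong refl) (use k in force)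
  have obs0: "restrict (observation w S \<epsilon> \<theta>\<^sub>0 \<omega>) J = \<psi> (\<lambda>i\<in>{..<n}. X i \<omega> - h i)" if "\<omega> \<in> space M" for \<omega>
    unfolding obs[OF that] \<psi>_restrict unfolding \<psi>_def using \<epsilon>
    by (intro restrict_ext sum.cong refl) (simp add: c_def h_def field_simps)
  have obs1: "restrict (observation w S \<epsilon> \<theta>\<^sub>1 \<omega>) J = \<psi> (\<lambda>i\<in>{..<n}. X i \<omega> + h i)" if "\<omega> \<in> space M" for \<omega>
    unfolding obs[OF that] \<psi>_restrict unfolding \<psi>_def using \<epsilon>
    by (intro restrict_ext sum.cong refl) (simp add: c_def h_def field_simps)
  have inB': "(\<lambda>i\<in>{..<n}. z i) \<in> B' \<longleftrightarrow> \<psi> (\<lambda>i\<in>{..<n}. z i) \<in> B" for z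
    by (auto simp: B'_def space_PiM)
  have ind: "indep_vars (\<lambda>_. borel) X {..<n}"
    using w \<tau>_mono \<tau>_rng unfolding wiener_process_def X_def[abs_def] by blast
  have X: "distributed M lborel (X i) (normal_density 0 (s i))" if "i \<in> {..<n}" for i
    using w \<tau>_less[of i] that unfolding wiener_process_def X_def[abs_def] s_def by auto
  let ?g = "\<lambda>t. S t \<theta>\<^sub>1 - S t \<theta>\<^sub>0"
  have g: "?g \<in> L2_unit" using L2_unit_linear[OF S(2,1), of 1 "-1"] by simp
  have hs: "(h i / s i)\<^sup>2 = (drift ?g (\<tau> (Suc i)) - drift ?g (\<tau> i))\<^sup>2 / (\<tau> (Suc i) - \<tau> i) / (2 * \<epsilon>)\<^sup>2"
    if "i < n" for i
  proof -
    have "m \<theta>\<^sub>1 i - m \<theta>\<^sub>0 i = drift ?g (\<tau> (Suc i)) - drift ?g (\<tau> i)"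
      using \<tau>_less[OF that] by (simp add: m_def F_def drift_subtract[OF S(2,1)])
    then show ?thesis
      using \<tau>_less[OF that] by (simp add: h_def s_def power_divide power_mult_distrib)
  qed
  have "(\<Sum>i<n. (h i / s i)\<^sup>2)
      = (\<Sum>i<n. (drift ?g (\<tau> (Suc i)) - drift ?g (\<tau> i))\<^sup>2 / (\<tau> (Suc i) - \<tau> i)) / (2 * \<epsilon>)\<^sup>2"
    by (simp add: hs sum_divide_distrib)
  also have "\<dots> \<le> (2 * \<epsilon> * \<kappa>)\<^sup>2 / (2 * \<epsilon>)\<^sup>2"
    by (intro divide_right_mono order_trans[OF drift_increment_sum_le[OF g \<tau>_mono \<tau>_rng] dist]) simp
  also have "\<dots> = \<kappa>\<^sup>2" using \<epsilon> by (simp add: power_mult_distrib)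
  finally have le: "(\<Sum>i<n. (h i / s i)\<^sup>2) \<le> \<kappa>\<^sup>2" .
  have "exp (- \<kappa>\<^sup>2 / 2 - \<kappa>) \<le> prob {\<omega> \<in> space M. (\<lambda>i\<in>{..<n}. X i \<omega> - h i) \<in> B'}
      + prob {\<omega> \<in> space M. (\<lambda>i\<in>{..<n}. X i \<omega> + h i) \<notin> B'}"
  proof (rule normal_shift_two_point_bound[OF _ _ ind _ X B' \<kappa> le])
    show "{..<n} \<noteq> {}" using n(1) by (auto simp: lessThan_empty_iff)
    show "0 < s i" if "i \<in> {..<n}" for i using \<tau>_less[of i] that by (simp add: s_def)
  qed auto
  also have "{\<omega> \<in> space M. (\<lambda>i\<in>{..<n}. X i \<omega> - h i) \<in> B'}
      = {\<omega> \<in> space M. restrict (observation w S \<epsilon> \<theta>\<^sub>0 \<omega>) J \<in> B}"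
    by (auto simp: inB' obs0)
  also have "{\<omega> \<in> space M. (\<lambda>i\<in>{..<n}. X i \<omega> + h i) \<notin> B'}
      = {\<omega> \<in> space M. restrict (observation w S \<epsilon> \<theta>\<^sub>1 \<omega>) J \<notin> B}"
    by (auto simp: inB' obs1)
  finally show ?thesis .
qed

text \<open>The cylinder bound does not depend on \<open>J\<close>, so it survives approximation of
  an arbitrary event by cylinders under both laws simultaneously.\<close>

lemma (in prob_space) obs_law_two_point_bound:
  assumes w: "wiener_process M w"
    and S: "(\<lambda>t. S t \<theta>\<^sub>0) \<in> L2_unit" "(\<lambda>t. S t \<theta>\<^sub>1) \<in> L2_unit"
    and \<epsilon>: "\<epsilon> > 0" and \<kappa>: "\<kappa> > 0"
    and dist: "(LINT t|lebesgue_on {0<..<1}. (S t \<theta>\<^sub>1 - S t \<theta>\<^sub>0)\<^sup>2) \<le> (2 * \<epsilon> * \<kappa>)\<^sup>2"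
    and E: "E \<in> sets path_space"
  shows "exp (- \<kappa>\<^sup>2 / 2 - \<kappa>) \<le> measure (obs_law M w S \<epsilon> \<theta>\<^sub>0) E
      + measure (obs_law M w S \<epsilon> \<theta>\<^sub>1) (space path_space - E)"
proof -
  let ?P = "PiM {0..1::real} (\<lambda>_. borel :: real measure)"
  define Y where "Y \<theta> = observation w S \<epsilon> \<theta>" for \<theta>
  have Y[measurable]: "Y \<theta> \<in> measurable M ?P" for \<theta>
    unfolding Y_def by (rule measurable_observation_PiM[OF w])
  have Y': "Y \<theta>\<^sub>0 \<in> measurable M path_space" "Y \<theta>\<^sub>1 \<in> measurable M path_space"
    unfolding Y_def by (intro measurable_observation w S)+
  \<comment> \<open>The laws are carried to the full product over \<open>{0..1}\<close>, where
    cylinder approximation is available. As the observed paths are continuous, \<open>E\<close> and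
    its extension \<open>E'\<close> have the same preimages.\<close>
  define N where "N \<theta> = distr M ?P (Y \<theta>)" for \<theta>
  interpret N: prob_space "N \<theta>" for \<theta>
    unfolding N_def by (rule prob_space_distr) simp
  have setsN[simp]: "sets (N \<theta>) = sets ?P" and spaceN[simp]: "space (N \<theta>) = space ?P" for \<theta>
    by (simp_all add: N_def)
  obtain E' where E': "E' \<in> sets ?P" "E = E' \<inter> {y. continuous_on {0..1} y}"
    using E by (auto simp: path_space_def sets_restrict_space)
  have law0: "measure (obs_law M w S \<epsilon> \<theta>\<^sub>0) E = measure (N \<theta>\<^sub>0) E'"
    using Y'(1) E E' measurable_space[OF Y'(1)]
    by (auto simp: obs_law_def N_def measure_distr Y_def[symmetric] path_space_def space_restrict_space
        intro!: arg_cong[where f=prob])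
  have law1: "measure (obs_law M w S \<epsilon> \<theta>\<^sub>1) (space path_space - E) = measure (N \<theta>\<^sub>1) (space ?P - E')"
  proof -
    have "measure (obs_law M w S \<epsilon> \<theta>\<^sub>1) (space path_space - E) = prob (Y \<theta>\<^sub>1 -` (space path_space - E) \<inter> space M)"
      using Y'(2) E by (simp add: obs_law_def Y_def measure_distr)
    also have "Y \<theta>\<^sub>1 -` (space path_space - E) \<inter> space M = Y \<theta>\<^sub>1 -` (space ?P - E') \<inter> space M"
      using measurable_space[OF Y'(2)] E'(2) by (auto simp: path_space_def space_restrict_space)
    also have "prob \<dots> = measure (N \<theta>\<^sub>1) (space ?P - E')"
      using E'(1) by (simp add: N_def measure_distr)
    finally show ?thesis .
  qed
  have "exp (- \<kappa>\<^sup>2 / 2 - \<kappa>) \<le> measure (N \<theta>\<^sub>0) E' + measure (N \<theta>\<^sub>1) (space ?P - E')"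
  proof (rule field_le_epsilon)
    fix e :: real assume "e > 0"
    obtain J B where J: "finite J" "J \<subseteq> {0..1}" and B: "B \<in> sets (PiM J (\<lambda>_. borel))"
      and ap: "measure (N \<theta>\<^sub>0) (sym_diff E' (prod_emb {0..1} (\<lambda>_. borel) J B)) < e / 2"
        "measure (N \<theta>\<^sub>1) (sym_diff E' (prod_emb {0..1} (\<lambda>_. borel) J B)) < e / 2"
      by (rule PiM_cylinder_approximation[of "N \<theta>\<^sub>0" "N \<theta>\<^sub>1" "{0..1}" E' "e / 2"])
         (use E' \<open>e > 0\<close> in \<open>auto intro: N.finite_measure_axioms\<close>)
    define C where "C = prod_emb {0..1} (\<lambda>_. borel :: real measure) J B"
    have C: "C \<in> sets ?P" unfolding C_def using J B by (intro measurable_prod_emb) auto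
    have inC: "y \<in> C \<longleftrightarrow> restrict y J \<in> B" if "y \<in> space ?P" for y
      using that by (auto simp: C_def prod_emb_def space_PiM)
    have "exp (- \<kappa>\<^sup>2 / 2 - \<kappa>) \<le> prob {\<omega> \<in> space M. restrict (Y \<theta>\<^sub>0 \<omega>) J \<in> B}
        + prob {\<omega> \<in> space M. restrict (Y \<theta>\<^sub>1 \<omega>) J \<notin> B}"
      unfolding Y_def by (rule cylinder_two_point_bound[OF w S \<epsilon> \<kappa> dist J B])
    also have "{\<omega> \<in> space M. restrict (Y \<theta>\<^sub>0 \<omega>) J \<in> B} = Y \<theta>\<^sub>0 -` C \<inter> space M"
      using measurable_space[OF Y] inC by auto
    also have "{\<omega> \<in> space M. restrict (Y \<theta>\<^sub>1 \<omega>) J \<notin> B} = Y \<theta>\<^sub>1 -` (space ?P - C) \<inter> space M"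
      using measurable_space[OF Y] inC by auto
    also have "prob (Y \<theta>\<^sub>0 -` C \<inter> space M) = measure (N \<theta>\<^sub>0) C"
      using C by (simp add: N_def measure_distr)
    also have "prob (Y \<theta>\<^sub>1 -` (space ?P - C) \<inter> space M) = measure (N \<theta>\<^sub>1) (space ?P - C)"
      using C by (simp add: N_def measure_distr)
    \<comment> \<open>Passing from \<open>C\<close> back to \<open>E'\<close> costs the mass of the
      symmetric difference, less than \<open>e / 2\<close> under each law.\<close>
    also have "measure (N \<theta>\<^sub>0) C \<le> measure (N \<theta>\<^sub>0) (E' \<union> sym_diff E' C)"
      using C E' by (intro N.finite_measure_mono) auto
    also have "\<dots> \<le> measure (N \<theta>\<^sub>0) E' + measure (N \<theta>\<^sub>0) (sym_diff E' C)"
      using C E' by (intro measure_Un_le) auto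
    also have "measure (N \<theta>\<^sub>1) (space ?P - C) \<le> measure (N \<theta>\<^sub>1) ((space ?P - E') \<union> sym_diff E' C)"
      using C E' by (intro N.finite_measure_mono) auto
    also have "\<dots> \<le> measure (N \<theta>\<^sub>1) (space ?P - E') + measure (N \<theta>\<^sub>1) (sym_diff E' C)"
      using C E' by (intro measure_Un_le) auto
    finally show "exp (- \<kappa>\<^sup>2 / 2 - \<kappa>) \<le> measure (N \<theta>\<^sub>0) E' + measure (N \<theta>\<^sub>1) (space ?P - E') + e"
      using ap by (simp add: C_def[symmetric])
  qed
  then show ?thesis by (simp add: law0 law1)
qed

section \<open>Asymptotics\<close>

text \<open>The signal difference is its linear part plus a remainder \<open>R\<close>. Young's
  inequality with weights \<open>1 + \<eta>\<close> and \<open>1 + 1 / \<eta>\<close> separates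
  them, and the remainder is absorbed near \<open>\<theta>\<^sub>0\<close> because it is of smaller
  order.\<close>

lemma A1_at_increment_bound:
  assumes A1: "A1_at S \<theta>\<^sub>0 D" and \<Theta>: "open \<Theta>" "\<theta>\<^sub>0 \<in> \<Theta>"
    and S: "\<And>\<theta>. \<theta> \<in> \<Theta> \<Longrightarrow> (\<lambda>t. S t \<theta>) \<in> L2_unit" and "\<eta> > 0"
  shows "\<forall>\<^sub>F \<theta> in at \<theta>\<^sub>0. (LINT t|lebesgue_on {0<..<1}. (S t \<theta> - S t \<theta>\<^sub>0)\<^sup>2)
      \<le> (1 + \<eta>)\<^sup>2 * (\<theta> - \<theta>\<^sub>0)\<^sup>2 * fisher_info D"
proof -
  let ?N = "lebesgue_on {0<..<1::real}"
  define I where "I = fisher_info D"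
  have I: "I > 0" and D: "D \<in> L2_unit" using A1 by (auto simp: A1_at_def I_def)
  define R where "R \<theta> t = S t \<theta> - S t \<theta>\<^sub>0 - (\<theta> - \<theta>\<^sub>0) * D t" for \<theta> t
  have "(\<lambda>\<theta>. LINT t|?N. (R \<theta> t)\<^sup>2) \<in> o[at \<theta>\<^sub>0](\<lambda>\<theta>. \<bar>\<theta> - \<theta>\<^sub>0\<bar>\<^sup>2)"
    using A1 by (simp add: A1_at_def R_def)
  \<comment> \<open>The constant for the little-o bound: once multiplied by the Young weight
    \<open>1 + 1 / \<eta>\<close>, the remainder contributes at most \<open>\<eta> * I\<close> times
    the squared shift.\<close>
  moreover have "\<eta> * I / (1 + 1 / \<eta>) > 0" using I \<open>\<eta> > 0\<close> by (simp add: add_pos_pos)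
  ultimately have "\<forall>\<^sub>F \<theta> in at \<theta>\<^sub>0. norm (LINT t|?N. (R \<theta> t)\<^sup>2) \<le> \<eta> * I / (1 + 1 / \<eta>) * norm (\<bar>\<theta> - \<theta>\<^sub>0\<bar>\<^sup>2)"
    by (rule landau_o.smallD)
  moreover have "\<forall>\<^sub>F \<theta> in at \<theta>\<^sub>0. \<theta> \<in> \<Theta>"
    using \<Theta> by (simp add: eventually_at_topological) blast
  ultimately show ?thesis
  proof eventually_elim
    fix \<theta> assume R: "norm (LINT t|?N. (R \<theta> t)\<^sup>2) \<le> \<eta> * I / (1 + 1 / \<eta>) * norm (\<bar>\<theta> - \<theta>\<^sub>0\<bar>\<^sup>2)" and "\<theta> \<in> \<Theta>"
    let ?h = "\<theta> - \<theta>\<^sub>0"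
    have g: "(\<lambda>t. S t \<theta> - S t \<theta>\<^sub>0) \<in> L2_unit"
      using L2_unit_linear[OF S[OF \<open>\<theta> \<in> \<Theta>\<close>] S[OF \<Theta>(2)], of 1 "-1"] by simp
    have "R \<theta> = (\<lambda>t. 1 * (S t \<theta> - S t \<theta>\<^sub>0) + (- ?h) * D t)" by (simp add: R_def fun_eq_iff algebra_simps)
    then have Rm: "R \<theta> \<in> L2_unit" using L2_unit_linear[OF g D] by metis
    have int: "integrable ?N (\<lambda>t. (f t)\<^sup>2)" if "f \<in> L2_unit" for f using that by (simp add: L2_unit_def)
    have young: "(a + b)\<^sup>2 \<le> (1 + \<eta>) * a\<^sup>2 + (1 + 1 / \<eta>) * b\<^sup>2" for a b :: real
    proof -
      have "0 \<le> (\<eta> * a - b)\<^sup>2 / \<eta>" using \<open>\<eta> > 0\<close> by simp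
      also have "\<dots> = \<eta> * a\<^sup>2 - 2 * a * b + b\<^sup>2 / \<eta>"
        using \<open>\<eta> > 0\<close> by (simp add: power2_eq_square field_simps)
      finally show ?thesis by (simp add: power2_sum algebra_simps)
    qed
    have "(LINT t|?N. (S t \<theta> - S t \<theta>\<^sub>0)\<^sup>2)
        \<le> (LINT t|?N. (1 + \<eta>) * ?h\<^sup>2 * (D t)\<^sup>2 + (1 + 1 / \<eta>) * (R \<theta> t)\<^sup>2)"
    proof (rule integral_mono)
      show "(S t \<theta> - S t \<theta>\<^sub>0)\<^sup>2 \<le> (1 + \<eta>) * ?h\<^sup>2 * (D t)\<^sup>2 + (1 + 1 / \<eta>) * (R \<theta> t)\<^sup>2" for t
        using young[of "?h * D t" "R \<theta> t"] by (simp add: R_def power_mult_distrib mult.assoc)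
    qed (use int[OF g] int[OF D] int[OF Rm] in auto)
    also have "\<dots> = (1 + \<eta>) * ?h\<^sup>2 * I + (1 + 1 / \<eta>) * (LINT t|?N. (R \<theta> t)\<^sup>2)"
      using int[OF D] int[OF Rm] by (simp add: I_def fisher_info_def)
    also have "(1 + 1 / \<eta>) * (LINT t|?N. (R \<theta> t)\<^sup>2) \<le> (1 + 1 / \<eta>) * (\<eta> * I / (1 + 1 / \<eta>) * ?h\<^sup>2)"
      using R \<open>\<eta> > 0\<close> by (intro mult_left_mono) auto
    also have "\<dots> = \<eta> * I * ?h\<^sup>2"
    proof -
      have "1 + 1 / \<eta> \<noteq> 0" using \<open>\<eta> > 0\<close> by (simp add: add_pos_pos less_imp_neq[symmetric])
      then show ?thesis by simp
    qed
    \<comment> \<open>The total factor \<open>1 + 2 * \<eta>\<close> is relaxed to a perfect square,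
      so that a square root can be taken when \<open>\<kappa>\<close> is chosen.\<close>
    also have "(1 + \<eta>) * ?h\<^sup>2 * I + \<eta> * I * ?h\<^sup>2 \<le> (1 + \<eta>)\<^sup>2 * ?h\<^sup>2 * I"
    proof -
      have "(1 + \<eta>)\<^sup>2 * ?h\<^sup>2 * I - ((1 + \<eta>) * ?h\<^sup>2 * I + \<eta> * I * ?h\<^sup>2) = \<eta>\<^sup>2 * ?h\<^sup>2 * I"
        by (simp add: power2_eq_square algebra_simps)
      also have "\<dots> \<ge> 0" using I by simp
      finally show ?thesis by simp
    qed
    finally show "(LINT t|?N. (S t \<theta> - S t \<theta>\<^sub>0)\<^sup>2) \<le> (1 + \<eta>)\<^sup>2 * ?h\<^sup>2 * fisher_info D"
      by (simp add: I_def)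
  qed
qed

text \<open>The larger of the two probabilities is at least half their sum, which costs
  \<open>ln 2\<close>. It is positive, so \<open>eln\<close> is the ordinary logarithm
  there.\<close>

lemma SUP_eln_two_point_ge:
  fixes p :: "real \<Rightarrow> real"
  assumes "K \<ge> 0" and "exp (- x) \<le> p a + p b"
  shows "ereal (K * (- ln 2 - x)) \<le> (SUP \<theta>\<in>{a, b}. ereal K * eln (p \<theta>))"
proof -
  obtain \<theta> where \<theta>: "\<theta> \<in> {a, b}" "exp (- x) / 2 \<le> p \<theta>"
  proof (cases "p a \<le> p b")
    case True then show ?thesis using that[of b] assms(2) by simp
  next
    case False then show ?thesis using that[of a] assms(2) by simp
  qed
  have pos: "p \<theta> > 0" using \<theta>(2) by (rule less_le_trans[rotated]) simp
  have "- ln 2 - x = ln (exp (- x) / 2)" by (simp add: ln_div)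
  also have "\<dots> \<le> ln (p \<theta>)" using \<theta>(2) pos by (subst ln_le_cancel_iff) auto
  finally have "ereal (K * (- ln 2 - x)) \<le> ereal K * eln (p \<theta>)"
    using pos \<open>K \<ge> 0\<close> by (simp add: eln_def mult_left_mono)
  also have "\<dots> \<le> (SUP \<theta>\<in>{a, b}. ereal K * eln (p \<theta>))"
    using \<theta>(1) by (rule SUP_upper)
  finally show ?thesis .
qed

text \<open>Turns slack below -1/2 into room for the factor \<open>1 + \<eta>\<close>, by continuity
  at \<open>\<eta> = 0\<close>.\<close>

lemma ereal_less_neg_halfE:
  assumes "y < ereal (- 1 / 2)"
  obtains \<eta> where "\<eta> > 0" "y < ereal (- (1 + \<eta>)\<^sup>2 / 2)"
proof -
  \<comment> \<open>A real number between \<open>y\<close> and the bound also covers the case that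
    \<open>y\<close> is \<open>-\<infinity>\<close>.\<close>
  obtain c where c: "y \<le> ereal c" "c < - 1 / 2"
    using assms by (cases y) (auto intro: that[of "-1"])
  have "((\<lambda>\<eta>::real. - (1 + \<eta>)\<^sup>2 / 2) \<longlongrightarrow> - (1 + 0)\<^sup>2 / 2) (at_right 0)"
    by (intro tendsto_intros) auto
  then have "\<forall>\<^sub>F \<eta> in at_right 0. c < - (1 + \<eta>)\<^sup>2 / 2"
    using c(2) by (intro order_tendstoD(1)) auto
  moreover have "\<forall>\<^sub>F \<eta> in at_right (0::real). \<eta> > 0" by (rule eventually_at_right_less)
  ultimately have "\<forall>\<^sub>F \<eta> in at_right 0. c < - (1 + \<eta>)\<^sup>2 / 2 \<and> \<eta> > 0" by (rule eventually_conj)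
  then obtain \<eta> where "\<eta> > 0" "c < - (1 + \<eta>)\<^sup>2 / 2"
    using eventually_happens[of _ "at_right (0::real)"] by auto
  with c(1) show ?thesis by (intro that[of \<eta>]) (auto intro: le_less_trans)
qed

theorem theorem2p2:
  fixes M :: "'a measure" and w :: "real \<Rightarrow> 'a \<Rightarrow> real"
    and S :: "real \<Rightarrow> real \<Rightarrow> real" and \<Theta> :: "real set" and \<theta>0 :: real
    and D :: "real \<Rightarrow> real" and u :: "real \<Rightarrow> real"
    and T :: "real \<Rightarrow> (real \<Rightarrow> real) \<Rightarrow> real"
  assumes "prob_space M" and "wiener_process M w"
    and "open \<Theta>" and "\<theta>0 \<in> \<Theta>"
    and "\<And>\<theta>. \<theta> \<in> \<Theta> \<Longrightarrow> (\<lambda>t. S t \<theta>) \<in> L2_unit"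
    and "A1_at S \<theta>0 D"
    and "\<And>\<epsilon>. \<epsilon> > 0 \<Longrightarrow> u \<epsilon> > 0"
    and "(u \<longlongrightarrow> 0) (at_right 0)"
    and "filterlim (\<lambda>\<epsilon>. inverse \<epsilon> * u \<epsilon>) at_top (at_right 0)"
    and "\<And>\<epsilon>. \<epsilon> > 0 \<Longrightarrow> T \<epsilon> \<in> borel_measurable path_space"
  shows "Liminf (at_right 0) (\<lambda>\<epsilon>. SUP \<theta>\<in>{\<theta>0, \<theta>0 + 2 * u \<epsilon>}.
           ereal (\<epsilon>\<^sup>2 * inverse ((u \<epsilon>)\<^sup>2) * inverse (fisher_info D)) *
           eln (measure (obs_law M w S \<epsilon> \<theta>)
                  {y \<in> space path_space. \<bar>T \<epsilon> y - \<theta>\<bar> \<ge> u \<epsilon>}))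
         \<ge> ereal (- 1 / 2)"
proof -
  interpret prob_space M by fact
  note w = assms(2) and \<Theta> = assms(3,4) and S = assms(5) and u_pos = assms(7)
  define I where "I = fisher_info D"
  have I: "I > 0" using assms(6) by (simp add: A1_at_def I_def)
  \<comment> \<open>The signal-to-noise ratio; the normalising factor of the logarithm is
    \<open>(inverse (r \<epsilon>))\<^sup>2\<close>.\<close>
  define r where "r \<epsilon> = inverse \<epsilon> * u \<epsilon> * sqrt I" for \<epsilon>
  define p where "p \<epsilon> \<theta> = measure (obs_law M w S \<epsilon> \<theta>)
      {y \<in> space path_space. \<bar>T \<epsilon> y - \<theta>\<bar> \<ge> u \<epsilon>}" for \<epsilon> \<theta>
  define G where "G \<epsilon> = (SUP \<theta>\<in>{\<theta>0, \<theta>0 + 2 * u \<epsilon>}.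
      ereal (\<epsilon>\<^sup>2 * inverse ((u \<epsilon>)\<^sup>2) * inverse (fisher_info D)) * eln (p \<epsilon> \<theta>))" for \<epsilon>
  have r_top: "filterlim r at_top (at_right 0)"
    unfolding r_def[abs_def] using I
    by (intro filterlim_at_top_mult_tendsto_pos[OF tendsto_const _ assms(9)]) simp
  have pos: "\<forall>\<^sub>F \<epsilon> in at_right (0::real). \<epsilon> > 0" by (rule eventually_at_right_less)
  \<comment> \<open>The expansion in A1 concerns the punctured neighbourhood
    \<open>at \<theta>0\<close>, so the shift must be nonzero as well as tend to 0.\<close>
  have lim: "filterlim (\<lambda>\<epsilon>. \<theta>0 + 2 * u \<epsilon>) (at \<theta>0) (at_right 0)"
    unfolding filterlim_at
  proof
    show "\<forall>\<^sub>F \<epsilon> in at_right 0. \<theta>0 + 2 * u \<epsilon> \<in> UNIV \<and> \<theta>0 + 2 * u \<epsilon> \<noteq> \<theta>0"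
      using pos by eventually_elim (use u_pos in force)
    show "((\<lambda>\<epsilon>. \<theta>0 + 2 * u \<epsilon>) \<longlongrightarrow> \<theta>0) (at_right 0)"
      by (rule tendsto_eq_intros assms(8) refl | simp)+
  qed
  have \<Theta>_ev: "\<forall>\<^sub>F \<theta> in at \<theta>0. \<theta> \<in> \<Theta>"
    using \<Theta> by (simp add: eventually_at_topological) blast
  have "ereal (- 1 / 2) \<le> Liminf (at_right 0) G"
    unfolding le_Liminf_iff
  proof (intro allI impI)
    fix y assume "y < ereal (- 1 / 2)"
    then obtain \<eta> where \<eta>: "\<eta> > 0" "y < ereal (- (1 + \<eta>)\<^sup>2 / 2)" by (rule ereal_less_neg_halfE)
    have bnd: "\<forall>\<^sub>F \<epsilon> in at_right 0. (LINT t|lebesgue_on {0<..<1}. (S t (\<theta>0 + 2 * u \<epsilon>) - S t \<theta>0)\<^sup>2)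
        \<le> (1 + \<eta>)\<^sup>2 * (2 * u \<epsilon>)\<^sup>2 * I"
      using eventually_compose_filterlim[OF A1_at_increment_bound[OF assms(6) \<Theta> S \<eta>(1)] lim]
      by (simp add: I_def)
    have \<Theta>1: "\<forall>\<^sub>F \<epsilon> in at_right 0. \<theta>0 + 2 * u \<epsilon> \<in> \<Theta>"
      by (rule eventually_compose_filterlim[OF \<Theta>_ev lim])
    have inv0: "((\<lambda>\<epsilon>. inverse (r \<epsilon>)) \<longlongrightarrow> 0) (at_right 0)"
      by (rule tendsto_inverse_0_at_top[OF r_top])
    \<comment> \<open>This is \<open>- ln 2 - \<kappa>\<^sup>2 / 2 - \<kappa>\<close> divided by the
      square of \<open>r \<epsilon>\<close>, for
      \<open>\<kappa> = (1 + \<eta>) * r \<epsilon>\<close>. Only the quadratic term survives as the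
      ratio grows.\<close>
    have "((\<lambda>\<epsilon>. - ln 2 * (inverse (r \<epsilon>))\<^sup>2 - (1 + \<eta>)\<^sup>2 / 2 - (1 + \<eta>) * inverse (r \<epsilon>))
        \<longlongrightarrow> - ln 2 * 0\<^sup>2 - (1 + \<eta>)\<^sup>2 / 2 - (1 + \<eta>) * 0) (at_right 0)"
      by (intro tendsto_intros inv0)
    then have "((\<lambda>\<epsilon>. ereal (- ln 2 * (inverse (r \<epsilon>))\<^sup>2 - (1 + \<eta>)\<^sup>2 / 2 - (1 + \<eta>) * inverse (r \<epsilon>)))
        \<longlongrightarrow> ereal (- (1 + \<eta>)\<^sup>2 / 2)) (at_right 0)"
      by simp
    then have "\<forall>\<^sub>F \<epsilon> in at_right 0.
        y < ereal (- ln 2 * (inverse (r \<epsilon>))\<^sup>2 - (1 + \<eta>)\<^sup>2 / 2 - (1 + \<eta>) * inverse (r \<epsilon>))"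
      using \<eta>(2) by (rule order_tendstoD(1))
    then show "\<forall>\<^sub>F \<epsilon> in at_right 0. y < G \<epsilon>"
      using bnd \<Theta>1 pos
    proof eventually_elim
      fix \<epsilon> :: real
      assume y: "y < ereal (- ln 2 * (inverse (r \<epsilon>))\<^sup>2 - (1 + \<eta>)\<^sup>2 / 2 - (1 + \<eta>) * inverse (r \<epsilon>))"
        and bnd: "(LINT t|lebesgue_on {0<..<1}. (S t (\<theta>0 + 2 * u \<epsilon>) - S t \<theta>0)\<^sup>2)
          \<le> (1 + \<eta>)\<^sup>2 * (2 * u \<epsilon>)\<^sup>2 * I"
        and \<Theta>1: "\<theta>0 + 2 * u \<epsilon> \<in> \<Theta>" and "\<epsilon> > 0"
      let ?\<theta>1 = "\<theta>0 + 2 * u \<epsilon>"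
      have u: "u \<epsilon> > 0" using u_pos \<open>\<epsilon> > 0\<close> .
      have T[measurable]: "T \<epsilon> \<in> borel_measurable path_space" using assms(10) \<open>\<epsilon> > 0\<close> .
      have r: "r \<epsilon> > 0" using u I \<open>\<epsilon> > 0\<close> by (simp add: r_def)
      \<comment> \<open>Chosen so that \<open>(2 * \<epsilon> * \<kappa>)\<^sup>2\<close> equals the
        bound from A1 for the shift \<open>2 * u \<epsilon>\<close>.\<close>
      define \<kappa> where "\<kappa> = (1 + \<eta>) * r \<epsilon>"
      have "\<kappa> > 0" using r \<eta> by (simp add: \<kappa>_def)
      have "(2 * \<epsilon> * \<kappa>)\<^sup>2 = (1 + \<eta>)\<^sup>2 * (2 * u \<epsilon>)\<^sup>2 * I"
        using I \<open>\<epsilon> > 0\<close> by (simp add: \<kappa>_def r_def power_mult_distrib power_inverse)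
      with bnd have dist: "(LINT t|lebesgue_on {0<..<1}. (S t ?\<theta>1 - S t \<theta>0)\<^sup>2) \<le> (2 * \<epsilon> * \<kappa>)\<^sup>2" by simp
      define A where "A = {y \<in> space path_space. \<bar>T \<epsilon> y - \<theta>0\<bar> \<ge> u \<epsilon>}"
      have A: "A \<in> sets path_space" unfolding A_def by measurable
      interpret P1: prob_space "obs_law M w S \<epsilon> ?\<theta>1"
        unfolding obs_law_def by (intro prob_space_distr measurable_observation w S \<Theta>1)
      have "exp (- (\<kappa>\<^sup>2 / 2 + \<kappa>)) \<le> measure (obs_law M w S \<epsilon> \<theta>0) A
          + measure (obs_law M w S \<epsilon> ?\<theta>1) (space path_space - A)"
        using obs_law_two_point_bound[OF w S[OF \<Theta>(2)] S[OF \<Theta>1] \<open>\<epsilon> > 0\<close> \<open>\<kappa> > 0\<close> dist A] by simp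
      also have "measure (obs_law M w S \<epsilon> \<theta>0) A = p \<epsilon> \<theta>0" by (simp add: p_def A_def)
      also have "measure (obs_law M w S \<epsilon> ?\<theta>1) (space path_space - A) \<le> p \<epsilon> ?\<theta>1"
        unfolding p_def
      proof (rule P1.finite_measure_mono)
        \<comment> \<open>By the triangle inequality, an estimate closer than
          \<open>u \<epsilon>\<close> to \<open>\<theta>0\<close> is farther than
          \<open>u \<epsilon>\<close> from the other point: the gap is twice the tolerance.\<close>
        show "space path_space - A \<subseteq> {y \<in> space path_space. \<bar>T \<epsilon> y - ?\<theta>1\<bar> \<ge> u \<epsilon>}"
          by (auto simp: A_def)
        have "{y \<in> space path_space. \<bar>T \<epsilon> y - ?\<theta>1\<bar> \<ge> u \<epsilon>} \<in> sets path_space" by measurable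
        then show "{y \<in> space path_space. \<bar>T \<epsilon> y - ?\<theta>1\<bar> \<ge> u \<epsilon>} \<in> P1.events"
          by (simp add: obs_law_def)
      qed
      finally have "exp (- (\<kappa>\<^sup>2 / 2 + \<kappa>)) \<le> p \<epsilon> \<theta>0 + p \<epsilon> ?\<theta>1" by simp
      define k where "k = \<epsilon>\<^sup>2 * inverse ((u \<epsilon>)\<^sup>2) * inverse (fisher_info D)"
      have k: "k = (inverse (r \<epsilon>))\<^sup>2"
        using I by (simp add: k_def r_def I_def[symmetric] power_mult_distrib power_inverse inverse_mult_distrib)
      have "k * (- ln 2 - (\<kappa>\<^sup>2 / 2 + \<kappa>))
          = - ln 2 * (inverse (r \<epsilon>))\<^sup>2 - (1 + \<eta>)\<^sup>2 / 2 - (1 + \<eta>) * inverse (r \<epsilon>)"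
        using r by (simp add: k \<kappa>_def power_mult_distrib field_simps power2_eq_square)
      moreover have "ereal (k * (- ln 2 - (\<kappa>\<^sup>2 / 2 + \<kappa>))) \<le> G \<epsilon>"
        unfolding G_def k_def[symmetric]
        by (rule SUP_eln_two_point_ge) (simp add: k, fact)
      ultimately show "y < G \<epsilon>" using y by (auto intro: less_le_trans)
    qed
  qed
  then show ?thesis by (simp add: G_def[abs_def] p_def)
qed

end
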